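(* Let $1<p\le q<\infty$, and let $b_0,b_1,c_0,c_1,b,c\in\mathbb{R}$ with $b\ge0$. Let $K:(0,\infty)\times(0,\infty)\to\mathbb{C}$ be continuous in the first variable, with $$|K(x,y)|\lesssim x^{b_1}y^{c_1},\qquad xy<1,$$ and let $G(x,y)$ be such that $\frac{d}{dx}G(x,y)=x^{b_0}K(x,y)$ and $$|G(x,y)|\lesssim x^by^c,\qquad xy\ge1.$$ Let $Ff(y)=y^{c_0}\int_0^\infty x^{b_0}f(x)K(x,y)\,dx$, $y>0$. Let $u,v$ be nonnegative measurable functions on $(0,\infty)$, and let $\lambda>1$, $C_0>1$. Suppose there exists $C>0$ such that for every $r>0$, $$\bigg(\int_0^{1/r}u(y)y^{(c_0+c_1)q}\,dy\bigg)^{1/q}\bigg(\int_0^rv(x)^{1-p'}x^{(b_0+b_1)p'}\,dx\bigg)^{1/p'}\le C,$$ $$\bigg(\int_{1/(\lambda r)}^\infty u(y)y^{(c+c_0)q}\,dy\bigg)^{1/q}\bigg(\int_r^\infty v(x)^{1-p'}x^{(b-1)p'}\,dx\bigg)^{1/p'}\le C.$$ Then the inequality $$\Vert Ff\Vert_{q,u}\lesssim\Vert f\Vert_{p,v}$$ holds for every admissible $f\in GM$ satisfying the $GM$ condition with constants $C_0,\lambda$, with a constant independent of $f$.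
   Context: General monotone functions: a function $f:(0,\infty)\to\mathbb{C}$ locally of bounded variation is in $GM$ (with constants $C_0,\lambda>1$) if $\int_x^{2x}|df(t)|\le\frac{C_0}{x}\int_{x/\lambda}^{\lambda x}|f(t)|\,dt$ for all $x>0$, where $\int|df(t)|$ is a Stieltjes integral (total variation). A function $f\in GM$ is admissible if $\int_0^1x^{b_0+b_1}|f(x)|\,dx+\int_1^\infty x^{b-1}|f(x)|\,dx<\infty$. For such $f$, the integral defining $Ff(y)$ is understood as an improper integral at infinity (it converges for every $y>0$). Notation: $\Vert f\Vert_{p,v}=\big(\int_0^\infty v(x)|f(x)|^p\,dx\big)^{1/p}$; $p'=p/(p-1)$. $A\lesssim B$ means $A\le cB$ with $c>0$ independent of $x,y,f$. Conventions: $0\cdot\infty=0$, and $v^{1-p'}=\infty$ where $v=0$. *)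

theory Defs
  imports "HOL-Analysis.Analysis"
begin

text \<open>Functions on the half-line \<open>(0, \<infinity>)\<close> are represented by functions on \<open>real\<close> whose values
  at nonpositive arguments are never used. Integrals of nonnegative functions are Lebesgue
  integrals with values in \<open>ennreal\<close>.\<close>

text \<open>Real powers on \<open>[0, \<infinity>]\<close>. In contrast to \<open>powr\<close> on the reals, a negative power of
  \<open>0\<close> is \<open>\<infinity>\<close>; this gives the convention \<open>v\<^sup>1\<^sup>-\<^sup>p\<^sup>' = \<infinity>\<close> where \<open>v = 0\<close>. The convention
  \<open>0 \<cdot> \<infinity> = 0\<close> is built into \<open>ennreal\<close>.\<close>

definition ennpowr :: "ennreal \<Rightarrow> real \<Rightarrow> ennreal" where
  "ennpowr x a =
     (if a = 0 then 1
      else if x = 0 then (if a < 0 then \<infinity> else 0)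
      else if x = \<infinity> then (if a < 0 then 0 else \<infinity>)
      else ennreal (enn2real x powr a))"

definition conj_exponent :: "real \<Rightarrow> real" where
  "conj_exponent p = p / (p - 1)"

definition weighted_norm :: "real \<Rightarrow> (real \<Rightarrow> real) \<Rightarrow> (real \<Rightarrow> complex) \<Rightarrow> ennreal" where
  "weighted_norm p v f =
     ennpowr (\<integral>\<^sup>+ x. ennreal (v x * norm (f x) powr p) \<partial>lebesgue_on {0<..}) (1 / p)"

text \<open>The total variation of \<open>f\<close> on \<open>[a, b]\<close>, written \<open>\<integral> \<bar>df\<bar>\<close> over \<open>[a, b]\<close> in the literature:
  the supremum over all partitions \<open>a \<le> t 0 \<le> \<dots> \<le> t n \<le> b\<close>.\<close>

definition variation :: "(real \<Rightarrow> complex) \<Rightarrow> real \<Rightarrow> real \<Rightarrow> ennreal" where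
  "variation f a b =
     (SUP (n, t) \<in> {(n :: nat, t :: nat \<Rightarrow> real). mono_on {..n} t \<and> t ` {..n} \<subseteq> {a..b}}.
        \<Sum>i<n. ennreal (norm (f (t (Suc i)) - f (t i))))"

definition locally_bv :: "(real \<Rightarrow> complex) \<Rightarrow> bool" where
  "locally_bv f \<longleftrightarrow> (\<forall>a b. 0 < a \<longrightarrow> a < b \<longrightarrow> variation f a b < \<infinity>)"

definition general_monotone :: "real \<Rightarrow> real \<Rightarrow> (real \<Rightarrow> complex) \<Rightarrow> bool" where
  "general_monotone C0 lam f \<longleftrightarrow>
     locally_bv f \<and>
     (\<forall>x>0. variation f x (2 * x)
        \<le> ennreal (C0 / x) * (\<integral>\<^sup>+ t. ennreal (norm (f t)) \<partial>lebesgue_on {x / lam..lam * x}))"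

definition admissible :: "real \<Rightarrow> real \<Rightarrow> real \<Rightarrow> (real \<Rightarrow> complex) \<Rightarrow> bool" where
  "admissible b0 b1 b f \<longleftrightarrow>
     (\<integral>\<^sup>+ x. ennreal (x powr (b0 + b1) * norm (f x)) \<partial>lebesgue_on {0<..<1})
     + (\<integral>\<^sup>+ x. ennreal (x powr (b - 1) * norm (f x)) \<partial>lebesgue_on {1<..}) < \<infinity>"

text \<open>The integral over \<open>(0, \<infinity>)\<close> is improper at \<open>\<infinity>\<close> only: Lebesgue integrability is required on
  every \<open>(0, R)\<close>.\<close>

definition has_improper_integral :: "(real \<Rightarrow> complex) \<Rightarrow> complex \<Rightarrow> bool" where
  "has_improper_integral g I \<longleftrightarrow>
     (\<forall>R>0. integrable (lebesgue_on {0<..<R}) g) \<and>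
     ((\<lambda>R. integral\<^sup>L (lebesgue_on {0<..<R}) g) \<longlongrightarrow> I) at_top"

definition transform_integrand ::
    "real \<Rightarrow> (real \<Rightarrow> real \<Rightarrow> complex) \<Rightarrow> (real \<Rightarrow> complex) \<Rightarrow> real \<Rightarrow> real \<Rightarrow> complex" where
  "transform_integrand b0 K f y = (\<lambda>x. of_real (x powr b0) * f x * K x y)"

definition transform ::
    "real \<Rightarrow> real \<Rightarrow> (real \<Rightarrow> real \<Rightarrow> complex) \<Rightarrow> (real \<Rightarrow> complex) \<Rightarrow> real \<Rightarrow> complex" where
  "transform b0 c0 K f y =
     of_real (y powr c0) * (THE I. has_improper_integral (transform_integrand b0 K f y) I)"

end

theory Submission
  imports Defs
begin

text \<open>The integral defining \<open>Ff(y)\<close> is split at \<open>x = 1/y\<close>. On \<open>(0, 1/y)\<close> the size of \<open>K\<close> alone gives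
  at most a constant times \<open>y\<^sup>c\<^sup>1 \<integral> x\<^sup>b\<^sup>0\<^sup>+\<^sup>b\<^sup>1 |f(x)| dx\<close> over \<open>(0, 1/y)\<close>. On \<open>(1/y, \<infinity>)\<close> the cancellation
  in \<open>K\<close> is needed, and it is available through the primitive \<open>G\<close>: on a dyadic block \<open>[a, 2a]\<close> the
  integral is at most a constant times \<open>sup |G|\<close> times \<open>|f(a)|\<close> plus the variation of \<open>f\<close> on the block.
  The \<open>GM\<close> condition bounds this last quantity by an average of \<open>|f|\<close> over the slightly larger
  interval \<open>[a/\<lambda>, max(\<lambda>, 2) a]\<close>. These larger intervals overlap boundedly often, so summation over
  the dyadic blocks to the right of \<open>1/y\<close> produces at most a constant times
  \<open>y\<^sup>c \<integral> x\<^sup>b\<^sup>-\<^sup>1 |f(x)| dx\<close> over \<open>(1/(\<lambda>y), \<infinity>)\<close> (\<open>general_monotone_tail_bound\<close>). The same estimate started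
  at a large \<open>a\<close> instead of \<open>1/y\<close> is the Cauchy criterion for the improper integral, because
  admissibility makes the right-hand side tend to \<open>0\<close>; this is \<open>transform_bound\<close>.

  It remains to bound two operators of Hardy type, one integrating \<open>|f|\<close> over \<open>(0, 1/y)\<close> and one over
  \<open>(1/(\<lambda>y), \<infinity>)\<close>. Both have the form \<open>y \<mapsto> \<integral> h f\<close> over the set \<open>\<tau>(x) < \<sigma>(y)\<close>, with \<open>\<tau>(x) = ln x\<close> and
  \<open>\<sigma>(y) = - ln y\<close> for the first and \<open>\<tau>(x) = - ln x\<close> and \<open>\<sigma>(y) = ln (\<lambda>y)\<close> for the second, and the two
  conditions on \<open>u\<close> and \<open>v\<close> are Muckenhoupt's test conditions for these operators. One abstract
  \<open>hardy_inequality\<close> therefore serves both. It is proved by cutting along the dyadic levels of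
  \<open>F(r) = \<integral> h f\<close> over \<open>\<tau> < r\<close>: if \<open>F(s\<^sub>k) = 2\<^sup>k\<close>, then the mass \<open>2\<^sup>k\<^sup>-\<^sup>1\<close> that \<open>h f\<close> has between \<open>s\<^sub>k\<^sub>-\<^sub>1\<close> and
  \<open>s\<^sub>k\<close> is estimated by Hoelder's inequality, the test condition at \<open>r = s\<^sub>k\<close> controls the measure of
  the set where \<open>F(\<sigma>(y))\<close> exceeds \<open>2\<^sup>k\<close>, and the blocks are disjoint, so their contributions add up
  because \<open>p \<le> q\<close>.\<close>

section \<open>Real powers on the extended half-line\<close>

lemma ennpowr_ennreal: "0 \<le> x \<Longrightarrow> 0 < a \<Longrightarrow> ennpowr (ennreal x) a = ennreal (x powr a)"
  by (cases "x = 0") (auto simp: ennpowr_def)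

lemma ennpowr_top: "0 < a \<Longrightarrow> ennpowr top a = top"
  by (simp add: ennpowr_def)

lemma ennpowr_0: "0 < a \<Longrightarrow> ennpowr 0 a = 0"
  by (simp add: ennpowr_def)

lemma ennpowr_1: "ennpowr x 1 = x"
  by (cases x) (auto simp: ennpowr_def)

lemma ennpowr_eq_0_iff: "0 < a \<Longrightarrow> ennpowr x a = 0 \<longleftrightarrow> x = 0"
  by (cases x) (auto simp: ennpowr_def ennreal_eq_0_iff)

lemma ennpowr_mono:
  assumes "0 < a" "x \<le> y" shows "ennpowr x a \<le> ennpowr y a"
proof (cases "y = top")
  case False
  with assms(2) obtain x' y' where "0 \<le> x'" "x' \<le> y'" "x = ennreal x'" "y = ennreal y'"
    by (metis ennreal_cases ennreal_le_iff top.extremum_unique)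
  then show ?thesis using assms(1) by (auto simp: ennpowr_ennreal powr_mono2 ennreal_leI)
qed (use assms in \<open>simp add: ennpowr_top\<close>)

lemma ennpowr_mult:
  assumes "0 < a" shows "ennpowr (x * y) a = ennpowr x a * ennpowr y a"
proof -
  consider "x = 0 \<or> y = 0" | "x = top" "y \<noteq> 0" | "y = top" "x \<noteq> 0" | "x < top" "y < top"
    by (metis top.not_eq_extremum)
  then show ?thesis
  proof cases
    case 4
    then obtain x' y' where "0 \<le> x'" "0 \<le> y'" "x = ennreal x'" "y = ennreal y'"
      by (metis ennreal_cases less_irrefl)
    then show ?thesis
      using assms by (simp add: ennreal_mult'[symmetric] ennpowr_ennreal powr_mult)
  qed (use assms in \<open>auto simp: ennpowr_0 ennpowr_top ennreal_top_mult ennreal_mult_top ennpowr_eq_0_iff\<close>)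
qed

lemma ennpowr_ennpowr:
  assumes "0 < a" "0 < b" shows "ennpowr (ennpowr x a) b = ennpowr x (a * b)"
  using assms by (cases x) (simp_all add: ennpowr_ennreal ennpowr_top powr_powr)

lemma ennpowr_add:
  assumes "0 < a" "0 < b" shows "ennpowr x (a + b) = ennpowr x a * ennpowr x b"
  using assms by (cases x) (simp_all add: ennpowr_ennreal ennpowr_top powr_add ennreal_mult)

lemma ennpowr_sum_le:
  assumes "0 < a"
  shows "ennpowr (x + y) a \<le> ennreal (2 powr a) * (ennpowr x a + ennpowr y a)"
proof -
  have "x + y \<le> 2 * max x y"
    by (metis add_mono max.cobounded1 max.cobounded2 mult_2)
  then have "ennpowr (x + y) a \<le> ennpowr (ennreal 2 * max x y) a"
    using assms by (intro ennpowr_mono) auto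
  also have "\<dots> = ennreal (2 powr a) * ennpowr (max x y) a"
    using assms by (simp only: ennpowr_mult ennpowr_ennreal)
  also have "\<dots> \<le> ennreal (2 powr a) * (ennpowr x a + ennpowr y a)"
    by (intro mult_left_mono) (auto simp: max_def add_increasing add_increasing2)
  finally show ?thesis .
qed

text \<open>Each term is at most the whole sum \<open>S\<close>, so \<open>a\<^sub>n\<^sup>r \<le> a\<^sub>n S\<^sup>r\<^sup>-\<^sup>1\<close>. With \<open>r = q/p\<close> this is
  the place where Hardy's inequality uses \<open>p \<le> q\<close>.\<close>

lemma suminf_ennpowr_le:
  assumes "1 \<le> r" shows "(\<Sum>n. ennpowr (a n) r) \<le> ennpowr (\<Sum>n. a n) r"
proof (cases "r = 1")
  case False
  with assms have r: "0 < r - 1" by simp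
  have sp: "ennpowr x r = x * ennpowr x (r - 1)" for x
    using ennpowr_add[of 1 "r - 1" x] r by (simp add: ennpowr_1)
  have "(\<Sum>n. ennpowr (a n) r) \<le> (\<Sum>n. a n * ennpowr (\<Sum>n. a n) (r - 1))"
    using r unfolding sp
    by (intro suminf_le mult_left_mono ennpowr_mono) (auto intro: sum_le_suminf[of a "{n}" for n, simplified])
  also have "\<dots> = ennpowr (\<Sum>n. a n) r"
    unfolding sp by simp
  finally show ?thesis .
qed (simp add: ennpowr_1)

section \<open>Hoelder's inequality with possibly vanishing weights\<close>

lemma conj_exponent_facts:
  assumes "1 < p"
  shows "1 < conj_exponent p" "1 / p + 1 / conj_exponent p = 1"
    "conj_exponent p / p = conj_exponent p - 1"
  using assms by (simp_all add: conj_exponent_def field_simps)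

text \<open>Young's inequality for the factors \<open>e v\<^sup>1\<^sup>/\<^sup>p f\<close> and \<open>h v\<^sup>-\<^sup>1\<^sup>/\<^sup>p / e\<close>. Where \<open>v\<close> vanishes and \<open>h\<close> does
  not, the negative power of \<open>0\<close> makes the right-hand side infinite, so the estimate is valid at
  every point and can be integrated. The free scale \<open>e\<close> is optimised only after integration.\<close>

lemma young_weighted:
  assumes p: "1 < p" and e: "0 < e" and nn: "0 \<le> v" "0 \<le> h" "0 \<le> f"
  defines "p' \<equiv> conj_exponent p"
  shows "ennreal (h * f) \<le> ennreal (e powr p) * ennreal (v * f powr p)
     + ennreal (e powr - p') * (ennpowr (ennreal v) (1 - p') * ennreal (h powr p'))"
proof -
  have p': "1 < p'" "1 / p + 1 / p' = 1" "p' / p = p' - 1"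
    using conj_exponent_facts[OF p] by (simp_all add: p'_def)
  consider "h = 0" | "v = 0" "0 < h" | "0 < v" "0 < h"
    using nn by linarith
  then show ?thesis
  proof cases
    case 2
    then have "ennreal (e powr - p') * (ennpowr (ennreal v) (1 - p') * ennreal (h powr p')) = top"
      using p' e by (auto simp: ennpowr_def ennreal_mult_top ennreal_top_mult ennreal_eq_0_iff)
    then show ?thesis by simp
  next
    case 3
    define a where "a = e * v powr (1 / p) * f"
    define b where "b = h * v powr (- 1 / p) / e"
    have nn': "0 \<le> a" "0 \<le> b" using e nn by (auto simp: a_def b_def)
    have "h * f = a * b"
      using 3 e by (simp add: a_def b_def powr_minus field_simps)
    also have "\<dots> \<le> a powr p / p + b powr p' / p'"
      using Youngs_inequality[OF p p'(1,2) nn'] .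
    also have "\<dots> \<le> a powr p + b powr p'"
      using p p' by (intro add_mono) (simp_all add: divide_le_eq mult_le_cancel_left1)
    also have "a powr p = e powr p * (v * f powr p)"
      using e 3 nn p by (simp add: a_def powr_mult powr_powr)
    also have "b powr p' = e powr - p' * (v powr (1 - p') * h powr p')"
    proof -
      have "b powr p' = h powr p' * v powr (- 1 / p * p') / e powr p'"
        using e 3 nn by (simp add: b_def powr_mult powr_powr powr_divide)
      also have "- 1 / p * p' = 1 - p'" using p'(3) by simp
      finally show ?thesis by (simp add: powr_minus field_simps)
    qed
    finally have "ennreal (h * f)
        \<le> ennreal (e powr p * (v * f powr p) + e powr - p' * (v powr (1 - p') * h powr p'))"
      by (rule ennreal_leI)
    also have "\<dots> = ennreal (e powr p) * ennreal (v * f powr p)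
        + ennreal (e powr - p') * (ennreal (v powr (1 - p')) * ennreal (h powr p'))"
      using nn by (simp add: ennreal_plus ennreal_mult)
    also have "ennreal (v powr (1 - p')) = ennpowr (ennreal v) (1 - p')"
      using 3 p' by (simp add: ennpowr_def)
    finally show ?thesis .
  qed simp
qed

lemma ennreal_eq_0_if_le_multiples:
  fixes I X :: ennreal
  assumes le: "\<And>d. 0 < d \<Longrightarrow> I \<le> ennreal d * X" and X: "X < top"
  shows "I = 0"
proof (rule ccontr)
  assume "I \<noteq> 0"
  obtain x where x: "0 \<le> x" "X = ennreal x" using X by (cases X) auto
  have "I \<le> ennreal x" using le[of 1] x by simp
  then obtain i where i: "0 \<le> i" "I = ennreal i" by (cases I) (auto simp: top_unique)
  then have "0 < i" using \<open>I \<noteq> 0\<close> by (cases "i = 0") auto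
  define d where "d = i / (2 * (x + 1))"
  have d: "0 < d" using \<open>0 < i\<close> x by (simp add: d_def)
  have "ennreal i \<le> ennreal (d * x)"
    using le[OF d] x(1) d unfolding x(2) i(2) by (subst ennreal_mult) auto
  then have "i \<le> d * x"
    using x d by (subst (asm) ennreal_le_iff) auto
  then have "i * (2 * (x + 1)) \<le> i * x" using x by (simp add: d_def field_simps)
  moreover have "i * x \<ge> 0" using x i by simp
  ultimately show False using \<open>0 < i\<close> by (simp add: algebra_simps)
qed

text \<open>For finite positive \<open>X\<close> and \<open>Y\<close> the choice \<open>e = (Y/X)\<close> to the power \<open>1/(p p')\<close> makes both summands
  equal to \<open>X\<^sup>1\<^sup>/\<^sup>p Y\<^sup>1\<^sup>/\<^sup>p\<^sup>'\<close>; the factor \<open>2\<close> is the price for dropping \<open>1/p\<close> and \<open>1/p'\<close> in Young's inequality.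
  The product form of Hoelder's inequality is false in the presence of the convention \<open>0 \<cdot> \<infinity> = 0\<close>:
  if \<open>f\<close> lives where \<open>v\<close> vanishes, then \<open>X = 0\<close> and \<open>Y = \<infinity>\<close>, while \<open>I\<close> may be positive. The extra
  factor \<open>n\<close> repairs this, because the test condition forces \<open>n = 0\<close> if \<open>Y = \<infinity>\<close>.\<close>

lemma holder_from_young:
  fixes I X Y n :: ennreal
  assumes p: "1 < p" and C: "0 < C"
  defines "p' \<equiv> conj_exponent p"
  assumes young: "\<And>e. 0 < e \<Longrightarrow> I \<le> ennreal (e powr p) * X + ennreal (e powr - p') * Y"
    and test: "n * ennpowr Y (1 / p') \<le> ennreal C"
  shows "n * I \<le> ennreal (2 * C) * ennpowr X (1 / p)"
proof -
  have p': "1 < p'" "1 / p + 1 / p' = 1" "p' / p = p' - 1"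
    using conj_exponent_facts[OF p] by (simp_all add: p'_def)
  have I0: "I = 0" if "Y = 0" "X < top"
  proof (rule ennreal_eq_0_if_le_multiples[OF _ that(2)])
    fix d :: real assume "0 < d"
    then show "I \<le> ennreal d * X"
      using young[of "d powr (1 / p)"] p that(1) by (simp add: powr_powr)
  qed
  have I0': "I = 0" if "X = 0" "Y < top"
  proof (rule ennreal_eq_0_if_le_multiples[OF _ that(2)])
    fix d :: real assume "0 < d"
    then show "I \<le> ennreal d * Y"
      using young[of "d powr (- 1 / p')"] p' that(1) by (simp add: powr_powr)
  qed
  consider "n = 0 \<or> X = top" | "n \<noteq> 0" "X < top" "Y = top" | "X < top" "Y = 0" | "X = 0" "Y < top"
    | "n = top" "X < top" "Y \<noteq> 0" | "n < top" "X \<noteq> 0" "X < top" "Y \<noteq> 0" "Y < top"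
    by (metis top.not_eq_extremum)
  then show ?thesis
  proof cases
    case 1
    then show ?thesis using p C by (auto simp: ennpowr_top ennreal_mult_top)
  next
    case 2
    then show ?thesis using test p' by (simp add: ennpowr_top ennreal_mult_top top_unique)
  next
    case 5
    then have "ennpowr Y (1 / p') \<noteq> 0" using p' by (simp add: ennpowr_eq_0_iff)
    then show ?thesis using test 5 by (simp add: ennreal_top_mult top_unique)
  next
    case 6
    obtain x y where x: "0 < x" "X = ennreal x" and y: "0 < y" "Y = ennreal y"
      using 6 by (cases X; cases Y) (auto simp: less_le)
    define e where "e = (y / x) powr (1 / (p * p'))"
    have e: "0 < e" using x y by (simp add: e_def)
    have "e powr p = (y / x) powr (1 / p')" using p by (simp add: e_def powr_powr)
    also have "\<dots> = y powr (1 / p') * x powr (1 / p) / x"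
    proof -
      have "x powr (1 / p') = x / x powr (1 / p)"
        using p'(2) x(1) by (metis (no_types) add_diff_cancel_left' powr_diff powr_one less_imp_le)
      then show ?thesis using x y by (simp add: powr_divide)
    qed
    finally have 1: "e powr p * x = x powr (1 / p) * y powr (1 / p')" using x by simp
    have "e powr - p' = (y / x) powr (- (1 / p))" using p' by (simp add: e_def powr_powr)
    also have "\<dots> = y powr (1 / p') * x powr (1 / p) / y"
    proof -
      have "y powr (1 / p) = y / y powr (1 / p')"
        using p'(2) y(1) by (metis (no_types) add_diff_cancel_right' powr_diff powr_one less_imp_le)
      then show ?thesis using x y by (simp add: powr_divide powr_minus field_simps)
    qed
    finally have 2: "e powr - p' * y = x powr (1 / p) * y powr (1 / p')" using y by simp
    have "I \<le> ennreal (e powr p * x) + ennreal (e powr - p' * y)"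
      using young[OF e] x y by (simp add: ennreal_mult)
    also have "\<dots> = 2 * (ennpowr X (1 / p) * ennpowr Y (1 / p'))"
      unfolding 1 2 using x y p p' by (simp add: ennpowr_ennreal ennreal_mult mult_2)
    finally have "n * I \<le> 2 * (n * ennpowr Y (1 / p')) * ennpowr X (1 / p)"
      by (metis (no_types, lifting) mult_left_mono mult.commute mult.left_commute zero_le)
    also have "\<dots> \<le> 2 * ennreal C * ennpowr X (1 / p)"
      using test by (intro mult_right_mono mult_left_mono) auto
    finally show ?thesis using C by (simp add: ennreal_mult)
  qed (use I0 I0' in auto)
qed

section \<open>The weighted Hardy inequality\<close>

text \<open>The distribution function of \<open>\<tau>\<close> is continuous: from the left by continuity from below, and
  from the right by continuity from above, since its values are finite and \<open>\<tau>\<close> has no atoms. Its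
  values tend to \<open>0\<close> at \<open>- \<infinity>\<close>, so the supremum of the arguments at which it is at most \<open>t\<close> is a
  point where it equals \<open>t\<close>.\<close>

lemma emeasure_sublevel_attained:
  fixes \<tau> :: "'a \<Rightarrow> real"
  assumes \<tau>[measurable]: "\<tau> \<in> borel_measurable M"
    and fin: "\<And>r. emeasure M {x \<in> space M. \<tau> x < r} < top"
    and null: "\<And>r. emeasure M {x \<in> space M. \<tau> x = r} = 0"
    and t: "0 < t" "t < emeasure M {x \<in> space M. \<tau> x < R}"
  shows "\<exists>s. emeasure M {x \<in> space M. \<tau> x < s} = t"
proof -
  define F where "F r = emeasure M {x \<in> space M. \<tau> x < r}" for r
  have mono: "F r \<le> F s" if "r \<le> s" for r s
    unfolding F_def using that by (intro emeasure_mono) auto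
  have finF: "F r \<noteq> \<infinity>" for r
    using fin[of r] by (simp add: F_def)
  define S where "S = {r. F r \<le> t}"
  have "(INF n::nat. F (- real n)) = emeasure M (\<Inter>n::nat. {x \<in> space M. \<tau> x < - real n})"
    unfolding F_def using finF
    by (intro INF_emeasure_decseq) (auto simp: decseq_def F_def)
  also have "(\<Inter>n::nat. {x \<in> space M. \<tau> x < - real n}) = {}"
  proof -
    have "\<exists>n::nat. \<not> \<tau> x < - real n" for x
      using reals_Archimedean2[of "- \<tau> x"] by (metis less_asym minus_less_iff)
    then show ?thesis by blast
  qed
  finally have "\<exists>n::nat. F (- real n) < t"
    using t(1) INF_less_iff[of "\<lambda>n::nat. F (- real n)" UNIV t] by auto
  then have ne: "S \<noteq> {}" by (metis S_def empty_iff less_imp_le mem_Collect_eq)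
  have ub: "r \<le> R" if "r \<in> S" for r
    using that t(2) mono[of R r] by (force simp: S_def F_def)
  then have bdd: "bdd_above S" by (auto simp: bdd_above_def)
  define s where "s = Sup S"
  have below: "F r \<le> t" if "r < s" for r
  proof -
    obtain r' where "r' \<in> S" "r < r'" using \<open>r < s\<close> less_cSup_iff[OF ne bdd] by (auto simp: s_def)
    then show ?thesis using mono[of r r'] by (auto simp: S_def)
  qed
  have above: "t \<le> F r" if "s < r" for r
  proof (rule ccontr)
    assume "\<not> t \<le> F r"
    then have "r \<in> S" by (auto simp: S_def)
    then show False using cSup_upper[OF _ bdd, of r] that by (auto simp: s_def)
  qed
  have inv_mono: "inverse (real (Suc n)) \<le> inverse (real (Suc m))" if "m \<le> n" for m n
    using that by (simp add: field_simps)
  have sp: "s - inverse (Suc n) < s" "s < s + inverse (Suc n)" for n by auto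
  have "(SUP n::nat. F (s - inverse (Suc n))) = emeasure M (\<Union>n::nat. {x \<in> space M. \<tau> x < s - inverse (Suc n)})"
    unfolding F_def
  proof (intro SUP_emeasure_incseq monoI subsetI)
    fix m n :: nat and x
    assume "m \<le> n" "x \<in> {x \<in> space M. \<tau> x < s - inverse (Suc m)}"
    then have "x \<in> space M" "\<tau> x < s - inverse (Suc m)" by auto
    then show "x \<in> {x \<in> space M. \<tau> x < s - inverse (Suc n)}"
      using inv_mono[OF \<open>m \<le> n\<close>] by (intro CollectI conjI) (assumption | linarith)+
  qed auto
  also have "(\<Union>n::nat. {x \<in> space M. \<tau> x < s - inverse (Suc n)}) = {x \<in> space M. \<tau> x < s}"
  proof -
    have "\<exists>n::nat. \<tau> x < s - inverse (Suc n)" if "\<tau> x < s" for x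
      using reals_Archimedean[of "s - \<tau> x"] that by (auto simp: field_simps)
    moreover have "\<tau> x < s" if "\<tau> x < s - inverse (Suc n)" for x and n :: nat
      using that sp(1)[of n] by linarith
    ultimately show ?thesis by blast
  qed
  also have "emeasure M {x \<in> space M. \<tau> x < s} = F s" by (simp add: F_def)
  finally have "F s \<le> t"
    using below[OF sp(1)] by (metis SUP_least)
  moreover have "t \<le> F s"
  proof -
    have "t \<le> (INF n::nat. F (s + inverse (Suc n)))"
      by (intro INF_greatest above sp)
    also have "\<dots> = emeasure M (\<Inter>n::nat. {x \<in> space M. \<tau> x < s + inverse (Suc n)})"
      unfolding F_def using finF
    proof (intro INF_emeasure_decseq antimonoI subsetI)
      fix m n :: nat and x
      assume "m \<le> n" "x \<in> {x \<in> space M. \<tau> x < s + inverse (Suc n)}"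
      then have "x \<in> space M" "\<tau> x < s + inverse (Suc n)" by auto
    then show "x \<in> {x \<in> space M. \<tau> x < s + inverse (Suc m)}"
      using inv_mono[OF \<open>m \<le> n\<close>] by (intro CollectI conjI) (assumption | linarith)+
    qed (auto simp: F_def)
    also have "(\<Inter>n::nat. {x \<in> space M. \<tau> x < s + inverse (Suc n)})
        = {x \<in> space M. \<tau> x < s} \<union> {x \<in> space M. \<tau> x = s}"
    proof -
      have "\<tau> x \<le> s" if *: "\<And>n::nat. \<tau> x < s + inverse (Suc n)" for x
      proof (rule ccontr)
        assume "\<not> \<tau> x \<le> s"
        then obtain n where "inverse (real (Suc n)) < \<tau> x - s"
          using reals_Archimedean[of "\<tau> x - s"] by auto
        with *[of n] show False by linarith
      qed
      moreover have "\<tau> x < s + inverse (Suc n)" if "\<tau> x \<le> s" for x and n :: nat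
        using that sp(2)[of n] by linarith
      ultimately show ?thesis by (force simp: le_less)
    qed
    also have "emeasure M \<dots> \<le> F s + 0"
      unfolding F_def null[of s, symmetric] by (intro emeasure_subadditive) auto
    finally show ?thesis by simp
  qed
  ultimately show ?thesis by (auto simp: F_def)
qed

lemma sublevel_integral_measurable:
  fixes \<tau> :: "'a \<Rightarrow> real"
  assumes fin: "\<And>r. (\<integral>\<^sup>+ x. g x * indicator {x. \<tau> x < r} x \<partial>M) < top"
  shows "(\<lambda>r. \<integral>\<^sup>+ x. g x * indicator {x. \<tau> x < r} x \<partial>M) \<in> borel_measurable borel"
    (is "?F \<in> _")
proof -
  have "?F r \<le> ?F s" if "r \<le> s" for r s
    using that by (intro nn_integral_mono) (auto simp: indicator_def)
  then have "mono (\<lambda>r. enn2real (?F r))"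
    using fin by (intro monoI enn2real_mono) auto
  then have "(\<lambda>r. ennreal (enn2real (?F r))) \<in> borel_measurable borel"
    by (intro measurable_compose[OF borel_measurable_mono measurable_ennreal]) auto
  also have "(\<lambda>r. ennreal (enn2real (?F r))) = ?F" using fin by simp
  finally show ?thesis .
qed

text \<open>This is the sufficiency half of Muckenhoupt's and Bradley's theorem. Stating it for arbitrary
  measure spaces that are compared by \<open>\<tau>\<close> and \<open>\<sigma>\<close> covers integration from \<open>0\<close> and integration up
  to \<open>\<infinity>\<close> at once, without a change of variables. The measure \<open>N\<close> carries the weight \<open>u\<close>.\<close>

lemma hardy_inequality:
  fixes M :: "'a measure" and N :: "'b measure" and \<tau> h f v :: "'a \<Rightarrow> real" and \<sigma> :: "'b \<Rightarrow> real"
  assumes p: "1 < p" "p \<le> q" and C: "0 < C"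
  defines "p' \<equiv> conj_exponent p"
  assumes [measurable]: "\<tau> \<in> borel_measurable M" "h \<in> borel_measurable M" "f \<in> borel_measurable M"
      "v \<in> borel_measurable M" "\<sigma> \<in> borel_measurable N"
    and nn: "\<And>x. x \<in> space M \<Longrightarrow> 0 \<le> h x" "\<And>x. x \<in> space M \<Longrightarrow> 0 \<le> f x" "\<And>x. x \<in> space M \<Longrightarrow> 0 \<le> v x"
    and null: "\<And>r. AE x in M. \<tau> x \<noteq> r"
    and fin: "\<And>r. (\<integral>\<^sup>+ x. ennreal (h x * f x) * indicator {x. \<tau> x < r} x \<partial>M) < top"
    and test: "\<And>r. ennpowr (emeasure N {y \<in> space N. r < \<sigma> y}) (1 / q)
        * ennpowr (\<integral>\<^sup>+ x. ennpowr (ennreal (v x)) (1 - p') * ennreal (h x powr p')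
                    * indicator {x. \<tau> x < r} x \<partial>M) (1 / p') \<le> ennreal C"
  shows "(\<integral>\<^sup>+ y. ennpowr (\<integral>\<^sup>+ x. ennreal (h x * f x) * indicator {x. \<tau> x < \<sigma> y} x \<partial>M) q \<partial>N)
    \<le> ennreal ((8 * C) powr q) * ennpowr (\<integral>\<^sup>+ x. ennreal (v x * f x powr p) \<partial>M) (q / p)"
proof -
  have q: "0 < q" "1 \<le> q / p" using p by auto
  have p': "1 < p'" using conj_exponent_facts[OF p(1)] by (simp_all add: p'_def)
  define P where "P = density M (\<lambda>x. ennreal (h x * f x))"
  have P: "emeasure P A = (\<integral>\<^sup>+ x. ennreal (h x * f x) * indicator A x \<partial>M)" if "A \<in> sets M" for A
    unfolding P_def using that by (intro emeasure_density) auto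
  have [simp, measurable_cong]: "sets P = sets M" and [simp]: "space P = space M"
    by (auto simp: P_def)
  define F where "F r = emeasure P {x \<in> space P. \<tau> x < r}" for r
  have F: "F r = (\<integral>\<^sup>+ x. ennreal (h x * f x) * indicator {x. \<tau> x < r} x \<partial>M)" for r
    unfolding F_def by (subst P) (auto intro!: nn_integral_cong simp: indicator_def)
  have F_mono: "F r \<le> F s" if "r \<le> s" for r s
    unfolding F_def using that by (intro emeasure_mono) auto
  have F_fin: "F r < top" for r
    unfolding F by (rule fin)
  have F_meas[measurable]: "F \<in> borel_measurable borel"
    unfolding F[abs_def] by (rule sublevel_integral_measurable[OF fin])
  \<comment> \<open>The levels \<open>2\<^sup>k\<close> that matter are those below some value \<open>F (\<sigma> y)\<close>. For them \<open>s k\<close> is a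
    point at which \<open>F\<close> equals \<open>2\<^sup>k\<close>, the block \<open>A k\<close> consists of the points between \<open>s (k - 1)\<close> and
    \<open>s k\<close>, and the set \<open>E k\<close>, where the value exceeds \<open>2\<^sup>k\<close>, lies in \<open>\<sigma> > s k\<close>.\<close>
  define J where "J k \<longleftrightarrow> (\<exists>y\<in>space N. ennreal (2 powr real_of_int k) < F (\<sigma> y))" for k :: int
  define s where "s k = (SOME s. F s = ennreal (2 powr real_of_int k))" for k :: int
  have J_mono: "J j" if "J k" "j \<le> k" for j k
  proof -
    have "ennreal (2 powr real_of_int j) \<le> ennreal (2 powr real_of_int k)"
      using that by (intro ennreal_leI) simp
    then show ?thesis using that unfolding J_def by (blast intro: le_less_trans)
  qed
  have s: "F (s k) = ennreal (2 powr real_of_int k)" if "J k" for k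
  proof -
    have "\<exists>s. F s = ennreal (2 powr real_of_int k)"
      unfolding F_def
    proof (rule bexE[OF that[unfolded J_def]], rule emeasure_sublevel_attained)
      show "emeasure P {x \<in> space P. \<tau> x < r} < top" for r using F_fin by (simp add: F_def)
      show "emeasure P {x \<in> space P. \<tau> x = r} = 0" for r
        using null[of r] by (subst P) (auto simp: nn_integral_0_iff_AE indicator_def elim!: eventually_mono)
      show "0 < ennreal (2 powr real_of_int k)" by simp
    qed (auto simp: F_def P_def)
    then show ?thesis unfolding s_def by (rule someI_ex)
  qed
  have s_mono: "s i \<le> s j" if "i \<le> j" "J j" for i j
  proof (cases "i = j")
    case False
    then have "F (s i) < F (s j)"
      using that J_mono[OF that(2,1)] by (simp add: s ennreal_less_iff)
    then show ?thesis using F_mono by (metis linorder_not_le nle_le)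
  qed simp
  define A where "A k = (if J k then {x \<in> space M. s (k - 1) \<le> \<tau> x \<and> \<tau> x < s k} else {})" for k
  define E where "E k = {y \<in> space N. ennreal (2 powr real_of_int k) < F (\<sigma> y)}" for k
  have [measurable]: "A k \<in> sets M" "E k \<in> sets N" for k
    by (auto simp: A_def E_def)
  have A_disj: "A i \<inter> A j = {}" if "i < j" for i j
  proof (cases "J j")
    case True
    then have "s i \<le> s (j - 1)" using that J_mono[OF True, of "j - 1"] by (intro s_mono) auto
    then show ?thesis by (auto simp: A_def)
  qed (auto simp: A_def)
  \<comment> \<open>The levels are indexed by all integers, which \<open>int_decode\<close> enumerates.\<close>
  have disj: "disjoint_family (\<lambda>n. A (int_decode n))"
    unfolding disjoint_family_on_def
    using A_disj proof (intro ballI impI)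
    fix m n :: nat assume "m \<noteq> n"
    then have "int_decode m < int_decode n \<or> int_decode n < int_decode m"
      using int_decode_eq by (metis linorder_neqE)
    then show "A (int_decode m) \<inter> A (int_decode n) = {}"
      using A_disj[of "int_decode m" "int_decode n"] A_disj[of "int_decode n" "int_decode m"] by blast
  qed
  define X where "X k = (\<integral>\<^sup>+ x. ennreal (v x * f x powr p) * indicator (A k) x \<partial>M)" for k
  have "(\<Sum>n. X (int_decode n)) = (\<integral>\<^sup>+ x. (\<Sum>n. ennreal (v x * f x powr p) * indicator (A (int_decode n)) x) \<partial>M)"
    unfolding X_def by (intro nn_integral_suminf[symmetric]) auto
  also have "\<dots> \<le> (\<integral>\<^sup>+ x. ennreal (v x * f x powr p) \<partial>M)"
    by (intro nn_integral_mono) (simp add: suminf_indicator[OF disj] split: split_indicator)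
  finally have X_sum: "(\<Sum>n. X (int_decode n)) \<le> (\<integral>\<^sup>+ x. ennreal (v x * f x powr p) \<partial>M)" .
  \<comment> \<open>The constant is \<open>8 C = 4 \<cdot> 2 C\<close>, with \<open>4\<close> from \<open>2\<^sup>k\<^sup>+\<^sup>1 = 4 \<cdot> 2\<^sup>k\<^sup>-\<^sup>1\<close> and \<open>2\<close> from \<open>holder_from_young\<close>.\<close>
  have block: "ennreal ((2 powr real_of_int (k + 1)) powr q) * emeasure N (E k)
      \<le> ennreal ((8 * C) powr q) * ennpowr (X k) (q / p)" for k
  proof (cases "J k")
    case False
    then have "E k = {}" by (auto simp: E_def J_def)
    then show ?thesis by simp
  next
    case True
    let ?n = "ennpowr (emeasure N {y \<in> space N. s k < \<sigma> y}) (1 / q)"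
    let ?w = "\<lambda>x. ennpowr (ennreal (v x)) (1 - p') * ennreal (h x powr p')"
    have J': "J (k - 1)" using J_mono[OF True] by simp
    have A: "A k = {x \<in> space P. \<tau> x < s k} - {x \<in> space P. \<tau> x < s (k - 1)}"
      using True by (auto simp: A_def)
    have "emeasure P (A k) = F (s k) - F (s (k - 1))"
      unfolding A F_def using F_fin s_mono[of "k - 1" k] True
      by (intro emeasure_Diff) (auto simp: F_def less_top[symmetric])
    also have "\<dots> = ennreal (2 powr real_of_int (k - 1))"
      using s[OF True] s[OF J'] by (simp add: ennreal_minus powr_diff)
    finally have mass: "emeasure P (A k) = ennreal (2 powr real_of_int (k - 1))" .
    have "?n * emeasure P (A k) \<le> ennreal (2 * C) * ennpowr (X k) (1 / p)"
    proof (rule holder_from_young[OF p(1) C])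
      fix e :: real assume e: "0 < e"
      have [measurable]: "(\<lambda>x. ?w x * indicator (A k) x) \<in> borel_measurable M"
        unfolding ennpowr_def by measurable
      have "emeasure P (A k) = (\<integral>\<^sup>+ x. ennreal (h x * f x) * indicator (A k) x \<partial>M)"
        by (simp add: P)
      also have "\<dots> \<le> (\<integral>\<^sup>+ x. ennreal (e powr p) * (ennreal (v x * f x powr p) * indicator (A k) x)
          + ennreal (e powr - p') * (?w x * indicator (A k) x) \<partial>M)"
        using young_weighted[OF p(1) e nn(3,1,2)] unfolding p'_def
        by (intro nn_integral_mono) (auto simp: indicator_def)
      also have "\<dots> = ennreal (e powr p) * X k + ennreal (e powr - p') * (\<integral>\<^sup>+ x. ?w x * indicator (A k) x \<partial>M)"
        unfolding X_def by (subst nn_integral_add) (auto simp: nn_integral_cmult)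
      finally show "emeasure P (A k) \<le> ennreal (e powr p) * X k
          + ennreal (e powr - conj_exponent p) * (\<integral>\<^sup>+ x. ?w x * indicator (A k) x \<partial>M)"
        by (simp add: p'_def)
    next
      have "ennpowr (\<integral>\<^sup>+ x. ?w x * indicator (A k) x \<partial>M) (1 / p')
        \<le> ennpowr (\<integral>\<^sup>+ x. ?w x * indicator {x. \<tau> x < s k} x \<partial>M) (1 / p')"
        using p' by (intro ennpowr_mono nn_integral_mono mult_left_mono) (auto simp: A_def indicator_def)
      then show "?n * ennpowr (\<integral>\<^sup>+ x. ?w x * indicator (A k) x \<partial>M) (1 / conj_exponent p) \<le> ennreal C"
        using test[of "s k"] by (fold p'_def) (meson mult_left_mono order_trans zero_le)
    qed
    then have "ennpowr (?n * ennreal (2 powr real_of_int (k - 1))) q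
        \<le> ennpowr (ennreal (2 * C) * ennpowr (X k) (1 / p)) q"
      using q by (intro ennpowr_mono) (simp_all add: mass)
    then have *: "emeasure N {y \<in> space N. s k < \<sigma> y} * ennreal ((2 powr real_of_int (k - 1)) powr q)
        \<le> ennreal ((2 * C) powr q) * ennpowr (X k) (q / p)"
      using q p C by (simp add: ennpowr_mult ennpowr_ennpowr ennpowr_1 ennpowr_ennreal del: powr_powr)
    have "E k \<subseteq> {y \<in> space N. s k < \<sigma> y}"
      using F_mono s[OF True] by (force simp: E_def not_le[symmetric])
    then have "ennreal ((2 powr real_of_int (k + 1)) powr q) * emeasure N (E k)
        \<le> ennreal ((2 powr real_of_int (k + 1)) powr q) * emeasure N {y \<in> space N. s k < \<sigma> y}"
      by (intro mult_left_mono emeasure_mono) auto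
    also have "\<dots> = ennreal (4 powr q * (2 powr real_of_int (k - 1)) powr q) * emeasure N {y \<in> space N. s k < \<sigma> y}"
    proof -
      have "2 powr real_of_int (k + 1) = 4 * 2 powr real_of_int (k - 1)"
        by (simp add: powr_add powr_diff)
      then show ?thesis by (simp only: powr_mult)
    qed
    also have "\<dots> = ennreal (4 powr q) * (emeasure N {y \<in> space N. s k < \<sigma> y} * ennreal ((2 powr real_of_int (k - 1)) powr q))"
      by (simp only: ennreal_mult[OF powr_ge_zero powr_ge_zero] mult_ac)
    also have "\<dots> \<le> ennreal (4 powr q) * (ennreal ((2 * C) powr q) * ennpowr (X k) (q / p))"
      by (intro mult_left_mono *) simp
    also have "\<dots> = ennreal ((8 * C) powr q) * ennpowr (X k) (q / p)"
    proof -
      have "(8 * C) powr q = 4 powr q * (2 * C) powr q"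
        using C powr_mult[of 4 "2 * C" q] by simp
      then show ?thesis by (simp add: ennreal_mult mult.assoc)
    qed
    finally show ?thesis .
  qed
  have pointwise: "ennpowr (F (\<sigma> y)) q
      \<le> (\<Sum>n. ennreal ((2 powr real_of_int (int_decode n + 1)) powr q) * indicator (E (int_decode n)) y)"
    if y: "y \<in> space N" for y
  proof (cases "F (\<sigma> y) = 0")
    case False
    obtain z where z: "F (\<sigma> y) = ennreal z" "0 < z"
      using F_fin[of "\<sigma> y"] False by (cases "F (\<sigma> y)") (auto simp: less_le)
    define k where "k = \<lceil>log 2 z\<rceil> - 1"
    have k: "real_of_int k < log 2 z" "log 2 z \<le> real_of_int (k + 1)"
      by (auto simp: k_def) linarith+
    have 1: "2 powr real_of_int k < z" and 2: "z \<le> 2 powr real_of_int (k + 1)"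
      using k z(2) by (simp_all add: less_log_iff log_le_iff)
    have "ennpowr (F (\<sigma> y)) q \<le> ennreal ((2 powr real_of_int (k + 1)) powr q)"
      using z q 2 by (simp add: ennpowr_ennreal ennreal_leI powr_mono2)
    also have "\<dots> = ennreal ((2 powr real_of_int (k + 1)) powr q) * indicator (E k) y"
      using 1 z y by (simp add: E_def ennreal_less_iff)
    also have "\<dots> \<le> (\<Sum>n. ennreal ((2 powr real_of_int (int_decode n + 1)) powr q) * indicator (E (int_decode n)) y)"
      using sum_le_suminf[of "\<lambda>n. ennreal ((2 powr real_of_int (int_decode n + 1)) powr q) * indicator (E (int_decode n)) y" "{int_encode k}"]
      by simp
    finally show ?thesis .
  qed (use q in \<open>simp add: ennpowr_0\<close>)
  have "(\<integral>\<^sup>+ y. ennpowr (F (\<sigma> y)) q \<partial>N)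
      \<le> (\<integral>\<^sup>+ y. (\<Sum>n. ennreal ((2 powr real_of_int (int_decode n + 1)) powr q) * indicator (E (int_decode n)) y) \<partial>N)"
    by (intro nn_integral_mono pointwise)
  also have "\<dots> = (\<Sum>n. ennreal ((2 powr real_of_int (int_decode n + 1)) powr q) * emeasure N (E (int_decode n)))"
    by (subst nn_integral_suminf) (auto simp: nn_integral_cmult_indicator)
  also have "\<dots> \<le> (\<Sum>n. ennreal ((8 * C) powr q) * ennpowr (X (int_decode n)) (q / p))"
    by (intro suminf_le block) auto
  also have "\<dots> \<le> ennreal ((8 * C) powr q) * ennpowr (\<Sum>n. X (int_decode n)) (q / p)"
    using suminf_ennpowr_le[OF q(2)] by (auto intro!: mult_left_mono)
  also have "\<dots> \<le> ennreal ((8 * C) powr q) * ennpowr (\<integral>\<^sup>+ x. ennreal (v x * f x powr p) \<partial>M) (q / p)"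
    using q p by (intro mult_left_mono ennpowr_mono X_sum) auto
  finally show ?thesis by (simp add: F)
qed

section \<open>Functions of locally bounded variation\<close>

lemma norm_diff_le_variation:
  assumes "a \<le> x" "x \<le> y" "y \<le> b"
  shows "ennreal (norm (f y - f x)) \<le> variation f a b"
proof -
  let ?t = "\<lambda>i::nat. if i = 0 then x else y"
  have "(1, ?t) \<in> {(n, t). mono_on {..n} t \<and> t ` {..n} \<subseteq> {a..b}}"
    using assms by (auto simp: mono_on_def)
  then show ?thesis
    unfolding variation_def by (rule SUP_upper2) simp
qed

lemma variation_add_norm_diff_le:
  assumes "a \<le> x" "x \<le> y"
  shows "variation f a x + ennreal (norm (f y - f x)) \<le> variation f a y"
proof -
  let ?P = "\<lambda>b. {(n :: nat, t :: nat \<Rightarrow> real). mono_on {..n} t \<and> t ` {..n} \<subseteq> {a..b}}"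
  have "(0, \<lambda>_. a) \<in> ?P x" using assms by (auto simp: mono_on_def)
  then have ne: "?P x \<noteq> {}" by blast
  have "variation f a x + ennreal (norm (f y - f x))
      = (SUP (n, t) \<in> ?P x. (\<Sum>i<n. ennreal (norm (f (t (Suc i)) - f (t i)))) + ennreal (norm (f y - f x)))"
    unfolding variation_def case_prod_unfold using ne by (intro ennreal_SUP_add_left[symmetric]) (simp add: case_prod_unfold)
  also have "\<dots> \<le> variation f a y"
  proof (rule SUP_least, clarify)
    fix n :: nat and t :: "nat \<Rightarrow> real"
    assume t: "mono_on {..n} t" "t ` {..n} \<subseteq> {a..x}"
    \<comment> \<open>Append both \<open>x\<close> and \<open>y\<close> to the partition.\<close>
    let ?t = "\<lambda>i. if i \<le> n then t i else if i = Suc n then x else y"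
    have le: "a \<le> t i" "t i \<le> x" if "i \<le> n" for i using t(2) that by auto
    have le_y: "t i \<le> y" if "i \<le> n" for i using le(2)[OF that] assms(2) by simp
    have "(Suc (Suc n), ?t) \<in> ?P y"
      using t(1) le le_y assms by (auto simp: mono_on_def intro: order_trans)
    then have "(\<Sum>i<Suc (Suc n). ennreal (norm (f (?t (Suc i)) - f (?t i)))) \<le> variation f a y"
      unfolding variation_def by (rule SUP_upper2) (simp only: case_prod_conv order_refl)
    moreover have "(\<Sum>i<n. ennreal (norm (f (?t (Suc i)) - f (?t i))))
        = (\<Sum>i<n. ennreal (norm (f (t (Suc i)) - f (t i))))"
      by (rule sum.cong) auto
    ultimately have "(\<Sum>i<n. ennreal (norm (f (t (Suc i)) - f (t i)))) + ennreal (norm (f x - f (t n)))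
        + ennreal (norm (f y - f x)) \<le> variation f a y"
      by (simp del: sum_ennreal)
    then show "(\<Sum>i<n. ennreal (norm (f (t (Suc i)) - f (t i)))) + ennreal (norm (f y - f x))
        \<le> variation f a y"
      by (rule order_trans[rotated]) (simp add: add_increasing2 add_right_mono del: sum_ennreal)
  qed
  finally show ?thesis .
qed

text \<open>The variation function \<open>V\<close> takes the place of the Jordan decomposition: since it dominates the
  increments of \<open>f\<close>, the functions \<open>V\<close>, \<open>V - Re f\<close> and \<open>V - Im f\<close> are monotone.\<close>

lemma variation_majorant:
  assumes "variation f a b < \<infinity>"
  obtains V where "\<And>x y. a \<le> x \<Longrightarrow> x \<le> y \<Longrightarrow> y \<le> b \<Longrightarrow> norm (f y - f x) \<le> V y - V x"
    and "\<And>x. 0 \<le> V x" and "V b = enn2real (variation f a b)"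
proof
  define V where "V x = enn2real (variation f a x)" for x
  show "norm (f y - f x) \<le> V y - V x" if "a \<le> x" "x \<le> y" "y \<le> b" for x y
  proof -
    have le: "variation f a x + ennreal (norm (f y - f x)) \<le> variation f a y"
      and le': "variation f a y \<le> variation f a b"
      using variation_add_norm_diff_le[of a x y f] variation_add_norm_diff_le[of a y b f] that
      by (auto intro: order_trans[rotated])
    have "variation f a x \<le> variation f a y"
      using le by (rule order_trans[rotated]) (simp add: add_increasing2)
    then have fin: "variation f a y < \<infinity>" "variation f a x < \<infinity>"
      using le' assms by (auto intro: le_less_trans)
    have "ennreal (V x + norm (f y - f x)) \<le> ennreal (V y)"
      using le fin by (simp add: V_def ennreal_plus)
    then have "V x + norm (f y - f x) \<le> V y"
      by (subst (asm) ennreal_le_iff) (simp_all add: V_def)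
    then show ?thesis by simp
  qed
qed simp_all

lemma second_mean_value_bound:
  fixes \<phi> \<gamma> :: "real \<Rightarrow> real"
  assumes ab: "a \<le> b" and \<phi>: "mono_on {a..b} \<phi>" and \<gamma>: "\<gamma> integrable_on {a..b}"
    and L: "\<And>c d. a \<le> c \<Longrightarrow> c \<le> d \<Longrightarrow> d \<le> b \<Longrightarrow> \<bar>integral {c..d} \<gamma>\<bar> \<le> L"
  shows "(\<lambda>x. \<phi> x * \<gamma> x) integrable_on {a..b}"
    and "\<bar>integral {a..b} (\<lambda>x. \<phi> x * \<gamma> x)\<bar> \<le> (\<bar>\<phi> a\<bar> + \<bar>\<phi> b\<bar>) * L"
proof -
  obtain c where c: "c \<in> {a..b}" "((\<lambda>x. \<phi> x * \<gamma> x) has_integral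
      (\<phi> a * integral {a..c} \<gamma> + \<phi> b * integral {c..b} \<gamma>)) {a..b}"
    using second_mean_value_theorem_full[OF \<gamma> ab, of \<phi>] \<phi> by (auto simp: mono_on_def)
  then show "(\<lambda>x. \<phi> x * \<gamma> x) integrable_on {a..b}" by blast
  have "\<bar>\<phi> a * integral {a..c} \<gamma> + \<phi> b * integral {c..b} \<gamma>\<bar>
      \<le> \<bar>\<phi> a\<bar> * \<bar>integral {a..c} \<gamma>\<bar> + \<bar>\<phi> b\<bar> * \<bar>integral {c..b} \<gamma>\<bar>"
    by (metis abs_mult abs_triangle_ineq)
  also have "\<dots> \<le> \<bar>\<phi> a\<bar> * L + \<bar>\<phi> b\<bar> * L"
    using c(1) by (intro add_mono mult_left_mono L) auto
  finally show "\<bar>integral {a..b} (\<lambda>x. \<phi> x * \<gamma> x)\<bar> \<le> (\<bar>\<phi> a\<bar> + \<bar>\<phi> b\<bar>) * L"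
    using c(2) by (simp add: integral_unique algebra_simps)
qed

text \<open>The second mean value theorem is applied to the two monotone functions in \<open>r = V - (V - r)\<close>.\<close>

lemma integral_bv_mult_bound_real:
  fixes r \<gamma> V :: "real \<Rightarrow> real"
  assumes ab: "a \<le> b" and V: "\<And>x y. a \<le> x \<Longrightarrow> x \<le> y \<Longrightarrow> y \<le> b \<Longrightarrow> \<bar>r y - r x\<bar> \<le> V y - V x"
    and V0: "\<And>x. 0 \<le> V x" and \<gamma>: "\<gamma> integrable_on {a..b}"
    and L: "\<And>c d. a \<le> c \<Longrightarrow> c \<le> d \<Longrightarrow> d \<le> b \<Longrightarrow> \<bar>integral {c..d} \<gamma>\<bar> \<le> L"
  shows "(\<lambda>x. r x * \<gamma> x) integrable_on {a..b}"
    and "\<bar>integral {a..b} (\<lambda>x. r x * \<gamma> x)\<bar> \<le> (5 * V b + 2 * \<bar>r a\<bar>) * L"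
proof -
  have L0: "0 \<le> L" using L[of a a] ab by simp
  have m1: "mono_on {a..b} V" and m2: "mono_on {a..b} (\<lambda>x. V x - r x)"
    using V by (fastforce simp: mono_on_def)+
  have b1: "(\<lambda>x. V x * \<gamma> x) integrable_on {a..b}"
      "\<bar>integral {a..b} (\<lambda>x. V x * \<gamma> x)\<bar> \<le> (\<bar>V a\<bar> + \<bar>V b\<bar>) * L"
    and b2: "(\<lambda>x. (V x - r x) * \<gamma> x) integrable_on {a..b}"
      "\<bar>integral {a..b} (\<lambda>x. (V x - r x) * \<gamma> x)\<bar> \<le> (\<bar>V a - r a\<bar> + \<bar>V b - r b\<bar>) * L"
    using second_mean_value_bound[OF ab m1 \<gamma>, of L] second_mean_value_bound[OF ab m2 \<gamma>, of L] L
    by blast+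
  have eq: "(\<lambda>x. r x * \<gamma> x) = (\<lambda>x. V x * \<gamma> x - (V x - r x) * \<gamma> x)"
    by (auto simp: algebra_simps)
  show "(\<lambda>x. r x * \<gamma> x) integrable_on {a..b}"
    unfolding eq using b1(1) b2(1) by (rule integrable_diff)
  have "\<bar>integral {a..b} (\<lambda>x. r x * \<gamma> x)\<bar>
      \<le> \<bar>integral {a..b} (\<lambda>x. V x * \<gamma> x)\<bar> + \<bar>integral {a..b} (\<lambda>x. (V x - r x) * \<gamma> x)\<bar>"
    by (subst eq, subst integral_diff[OF b1(1) b2(1)]) (rule abs_triangle_ineq4)
  also have "\<dots> \<le> (\<bar>V a\<bar> + \<bar>V b\<bar>) * L + (\<bar>V a - r a\<bar> + \<bar>V b - r b\<bar>) * L"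
    by (intro add_mono b1(2) b2(2))
  also have "\<dots> = (\<bar>V a\<bar> + \<bar>V b\<bar> + \<bar>V a - r a\<bar> + \<bar>V b - r b\<bar>) * L"
    by (simp add: algebra_simps)
  also have "\<dots> \<le> (5 * V b + 2 * \<bar>r a\<bar>) * L"
    using V[of a b] V0[of a] V0[of b] ab L0 by (intro mult_right_mono) linarith+
  finally show "\<bar>integral {a..b} (\<lambda>x. r x * \<gamma> x)\<bar> \<le> (5 * V b + 2 * \<bar>r a\<bar>) * L" .
qed

text \<open>The analogue of integration by parts: the primitive \<open>G\<close> enters only through its supremum, and \<open>f\<close>
  only through one value and its variation. It comes from the second mean value theorem, applied to
  each product of a real or imaginary part of \<open>f\<close> with one of \<open>g\<close>; that theorem also gives the
  integrability of the product.\<close>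

lemma integral_bv_mult_bound:
  fixes f g G :: "real \<Rightarrow> complex"
  assumes ab: "a \<le> b" and bv: "variation f a b < \<infinity>"
    and G: "\<And>x. a \<le> x \<Longrightarrow> x \<le> b \<Longrightarrow> (G has_vector_derivative g x) (at x)"
    and M: "\<And>x. a \<le> x \<Longrightarrow> x \<le> b \<Longrightarrow> norm (G x) \<le> M"
  shows "(\<lambda>x. f x * g x) integrable_on {a..b}"
    and "norm (integral {a..b} (\<lambda>x. f x * g x)) \<le> 40 * M * (norm (f a) + enn2real (variation f a b))"
proof -
  obtain V where V: "\<And>x y. a \<le> x \<Longrightarrow> x \<le> y \<Longrightarrow> y \<le> b \<Longrightarrow> norm (f y - f x) \<le> V y - V x"
    and V0: "\<And>x. 0 \<le> V x" and Vb: "V b = enn2real (variation f a b)"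
    using variation_majorant[OF bv] by metis
  have M0: "0 \<le> M" using M[of a] ab norm_ge_zero order_trans by blast
  \<comment> \<open>Real and imaginary part are treated at once, as real-linear maps that do not increase the norm.\<close>
  define is_part where "is_part P \<longleftrightarrow> P = Re \<or> P = Im" for P :: "complex \<Rightarrow> real"
  have part: "bounded_linear P" "\<bar>P z\<bar> \<le> norm z" if "is_part P" for P z
    using that abs_Re_le_cmod abs_Im_le_cmod
    by (auto simp: is_part_def bounded_linear_Re bounded_linear_Im)
  have gi: "((\<lambda>x. Q (g x)) has_integral (Q (G d) - Q (G c))) {c..d}"
    if "is_part Q" "a \<le> c" "c \<le> d" "d \<le> b" for Q c d
    using that G bounded_linear.has_vector_derivative[OF part(1)[OF that(1)]]
    by (intro fundamental_theorem_of_calculus) (auto intro: has_vector_derivative_at_within)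
  have L: "\<bar>integral {c..d} (\<lambda>x. Q (g x))\<bar> \<le> 2 * M"
    if "is_part Q" "a \<le> c" "c \<le> d" "d \<le> b" for Q c d
  proof -
    have "\<bar>Q (G d) - Q (G c)\<bar> \<le> norm (G d) + norm (G c)"
      using part(2)[OF that(1), of "G d"] part(2)[OF that(1), of "G c"] by linarith
    then show ?thesis
      using M[of c] M[of d] that integral_unique[OF gi[OF that]] by simp
  qed
  have VP: "\<bar>P (f y) - P (f x)\<bar> \<le> V y - V x" if "is_part P" "a \<le> x" "x \<le> y" "y \<le> b" for P x y
    using V[OF that(2-4)] part(2)[OF that(1), of "f y - f x"] part(1)[OF that(1)]
    by (simp add: bounded_linear.linear linear_diff)
  \<comment> \<open>Integrals of \<open>Q \<circ> g\<close> are differences of two values of \<open>Q \<circ> G\<close>, hence at most \<open>2 M\<close>. Each of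
    the four products of parts then contributes at most \<open>10 M (|f a| + V b)\<close>.\<close>
  have int: "(\<lambda>x. P (f x) * Q (g x)) integrable_on {a..b}"
    and bound: "\<bar>integral {a..b} (\<lambda>x. P (f x) * Q (g x))\<bar> \<le> 10 * M * (norm (f a) + V b)"
    if P: "is_part P" and Q: "is_part Q" for P Q
  proof -
    have gi': "(\<lambda>x. Q (g x)) integrable_on {a..b}" using gi[OF Q, of a b] ab by blast
    show "(\<lambda>x. P (f x) * Q (g x)) integrable_on {a..b}"
      by (rule integral_bv_mult_bound_real(1)[OF ab VP[OF P] V0 gi' L[OF Q]])
    have "\<bar>integral {a..b} (\<lambda>x. P (f x) * Q (g x))\<bar> \<le> (5 * V b + 2 * \<bar>P (f a)\<bar>) * (2 * M)"
      by (rule integral_bv_mult_bound_real(2)[OF ab VP[OF P] V0 gi' L[OF Q]])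
    also have "\<dots> \<le> (5 * V b + 5 * norm (f a)) * (2 * M)"
      using M0 part(2)[OF P, of "f a"] norm_ge_zero[of "f a"] by (intro mult_right_mono) linarith+
    finally show "\<bar>integral {a..b} (\<lambda>x. P (f x) * Q (g x))\<bar> \<le> 10 * M * (norm (f a) + V b)"
      by (simp add: algebra_simps)
  qed
  have RI: "is_part Re" "is_part Im" by (auto simp: is_part_def)
  have re: "((\<lambda>x. Re (f x * g x)) has_integral
      (integral {a..b} (\<lambda>x. Re (f x) * Re (g x)) - integral {a..b} (\<lambda>x. Im (f x) * Im (g x)))) {a..b}"
    unfolding times_complex.sel
    by (intro has_integral_diff integrable_integral int RI)
  have im: "((\<lambda>x. Im (f x * g x)) has_integral
      (integral {a..b} (\<lambda>x. Re (f x) * Im (g x)) + integral {a..b} (\<lambda>x. Im (f x) * Re (g x)))) {a..b}"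
    unfolding times_complex.sel
    by (intro has_integral_add integrable_integral int RI)
  have "((\<lambda>x. complex_of_real (Re (f x * g x)) + \<i> * complex_of_real (Im (f x * g x))) has_integral
     (complex_of_real (integral {a..b} (\<lambda>x. Re (f x) * Re (g x)) - integral {a..b} (\<lambda>x. Im (f x) * Im (g x)))
      + \<i> * complex_of_real (integral {a..b} (\<lambda>x. Re (f x) * Im (g x)) + integral {a..b} (\<lambda>x. Im (f x) * Re (g x))))) {a..b}"
    by (intro has_integral_add has_integral_mult_right has_integral_of_real re im)
  then have fg: "((\<lambda>x. f x * g x) has_integral
     (complex_of_real (integral {a..b} (\<lambda>x. Re (f x) * Re (g x)) - integral {a..b} (\<lambda>x. Im (f x) * Im (g x)))
      + \<i> * complex_of_real (integral {a..b} (\<lambda>x. Re (f x) * Im (g x)) + integral {a..b} (\<lambda>x. Im (f x) * Re (g x))))) {a..b}"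
    (is "(_ has_integral ?I) _")
    by (simp only: complex_eq[symmetric])
  then show "(\<lambda>x. f x * g x) integrable_on {a..b}" by blast
  have "norm ?I \<le> \<bar>Re ?I\<bar> + \<bar>Im ?I\<bar>" by (rule cmod_le)
  also have "\<dots> \<le> 4 * (10 * M * (norm (f a) + V b))"
  proof -
    define K where "K = 10 * M * (norm (f a) + V b)"
    have *: "\<bar>A - B\<bar> + \<bar>C + D\<bar> \<le> 4 * K" if "\<bar>A\<bar> \<le> K" "\<bar>B\<bar> \<le> K" "\<bar>C\<bar> \<le> K" "\<bar>D\<bar> \<le> K" for A B C D
      using that by linarith
    have "Re ?I = integral {a..b} (\<lambda>x. Re (f x) * Re (g x)) - integral {a..b} (\<lambda>x. Im (f x) * Im (g x))"
      "Im ?I = integral {a..b} (\<lambda>x. Re (f x) * Im (g x)) + integral {a..b} (\<lambda>x. Im (f x) * Re (g x))"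
      by simp_all
    then show ?thesis
      unfolding K_def[symmetric]
      using *[OF bound[OF RI(1) RI(1), folded K_def] bound[OF RI(2) RI(2), folded K_def]
        bound[OF RI(1) RI(2), folded K_def] bound[OF RI(2) RI(1), folded K_def]]
      by (simp only:)
  qed
  also have "\<dots> = 40 * M * (norm (f a) + V b)" by simp
  finally show "norm (integral {a..b} (\<lambda>x. f x * g x)) \<le> 40 * M * (norm (f a) + enn2real (variation f a b))"
    using integral_unique[OF fg] Vb by simp
qed

text \<open>On a compact subinterval the real and imaginary parts are differences of monotone functions, and
  compact intervals exhaust the half-line.\<close>

lemma locally_bv_borel_measurable:
  assumes "locally_bv f"
  shows "f \<in> borel_measurable (lebesgue_on {0<..})"
proof -
  have on: "(\<lambda>x. indicator {a..b} x *\<^sub>R f x) \<in> borel_measurable borel" if ab: "0 < a" "a < b" for a b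
  proof -
    have "variation f a b < \<infinity>" using assms ab by (simp add: locally_bv_def)
    then obtain V where V: "\<And>x y. a \<le> x \<Longrightarrow> x \<le> y \<Longrightarrow> y \<le> b \<Longrightarrow> norm (f y - f x) \<le> V y - V x"
      using variation_majorant by metis
    have mV: "V \<in> borel_measurable (restrict_space borel {a..b})"
    proof (intro borel_measurable_mono_on_fnc mono_onI)
      fix x y assume "x \<in> {a..b}" "y \<in> {a..b}" "x \<le> y"
      then have "0 \<le> V y - V x" by (intro order_trans[OF norm_ge_zero V]) auto
      then show "V x \<le> V y" by simp
    qed
    have mVP: "(\<lambda>x. V x - P (f x)) \<in> borel_measurable (restrict_space borel {a..b})"
      if P: "P = Re \<or> P = Im" for P
    proof (intro borel_measurable_mono_on_fnc mono_onI)
      fix x y assume xy: "x \<in> {a..b}" "y \<in> {a..b}" "x \<le> y"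
      have "\<bar>P (f y) - P (f x)\<bar> \<le> norm (f y - f x)"
        using P abs_Re_le_cmod[of "f y - f x"] abs_Im_le_cmod[of "f y - f x"] by auto
      then show "V x - P (f x) \<le> V y - P (f y)" using V[of x y] xy by auto
    qed
    have part: "(\<lambda>x. P (f x)) \<in> borel_measurable (restrict_space borel {a..b})"
      if P: "P = Re \<or> P = Im" for P
      using borel_measurable_diff[OF mV mVP[OF P]] by simp
    have "f \<in> borel_measurable (restrict_space borel {a..b})"
      using part[of Re] part[of Im] by (subst borel_measurable_complex_iff) simp
    then show ?thesis
      by (subst (asm) borel_measurable_restrict_space_iff) auto
  qed
  have "(\<lambda>x. indicator {0<..} x *\<^sub>R f x) \<in> borel_measurable borel"
  proof (rule borel_measurable_LIMSEQ_metric)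
    show "(\<lambda>x. indicator {inverse (real (Suc n)) .. real (Suc (Suc n))} x *\<^sub>R f x) \<in> borel_measurable borel" for n
      by (intro on) (auto simp: field_simps intro!: add_pos_nonneg)
    fix x :: real
    show "(\<lambda>n. indicator {inverse (real (Suc n)) .. real (Suc (Suc n))} x *\<^sub>R f x) \<longlonglongrightarrow> indicator {0<..} x *\<^sub>R f x"
    proof (cases "0 < x")
      case True
      obtain n1 where n1: "inverse (real (Suc n1)) < x" using reals_Archimedean[OF True] by auto
      obtain n2 :: nat where n2: "x < real n2" using reals_Archimedean2 by auto
      have "\<forall>\<^sub>F n in sequentially. indicator {inverse (real (Suc n)) .. real (Suc (Suc n))} x *\<^sub>R f x = f x"
      proof (intro eventually_sequentiallyI[of "max n1 n2"])
        fix n assume n: "max n1 n2 \<le> n"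
        then have "inverse (real (Suc n)) \<le> inverse (real (Suc n1))" "real n2 \<le> real n"
          by (auto simp: field_simps)
        then have "inverse (real (Suc n)) \<le> x" "x \<le> real (Suc (Suc n))"
          using n1 n2 by linarith+
        then show "indicator {inverse (real (Suc n)) .. real (Suc (Suc n))} x *\<^sub>R f x = f x"
          by (simp del: of_nat_Suc)
      qed
      then show ?thesis using True by (simp add: tendsto_eventually)
    next
      case False
      have "0 < inverse (real (Suc n))" for n by simp
      then have "x \<notin> {inverse (real (Suc n)) .. real (Suc (Suc n))}" for n
        using False by (meson atLeastAtMost_iff less_le_trans)
      then show ?thesis using False by simp
    qed
  qed
  then have "(\<lambda>x. indicator {0<..} x *\<^sub>R f x) \<in> borel_measurable lebesgue"
    by (intro measurable_completion) simp
  then show ?thesis by (subst borel_measurable_restrict_space_iff) auto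
qed

lemma locally_bv_weighted_measurable:
  assumes "locally_bv f" and S: "S \<in> sets lebesgue" "S \<subseteq> {0<..}"
  shows "(\<lambda>x. ennreal (x powr e * norm (f x)) * indicator S x) \<in> borel_measurable lebesgue"
proof -
  define f0 where "f0 x = indicator {0<..} x *\<^sub>R f x" for x
  have [measurable]: "f0 \<in> borel_measurable lebesgue"
    using locally_bv_borel_measurable[OF assms(1)] unfolding f0_def
    by (subst (asm) borel_measurable_restrict_space_iff) auto
  have [measurable]: "(\<lambda>x::real. x powr e) \<in> borel_measurable lebesgue"
    by (intro measurable_completion) measurable
  note S(1)[measurable]
  have "(\<lambda>x. ennreal (x powr e * norm (f x)) * indicator S x)
      = (\<lambda>x. ennreal (x powr e * norm (f0 x)) * indicator S x)"
    using S(2) by (auto simp: fun_eq_iff indicator_def f0_def)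
  then show ?thesis by simp
qed

lemma locally_bv_norm_measurable:
  assumes "locally_bv f" and S: "S \<in> sets lebesgue" "S \<subseteq> {0<..}"
  shows "(\<lambda>x. ennreal (norm (f x)) * indicator S x) \<in> borel_measurable lebesgue"
proof -
  have "(\<lambda>x. ennreal (x powr 0 * norm (f x)) * indicator S x) = (\<lambda>x. ennreal (norm (f x)) * indicator S x)"
    using S(2) by (auto simp: fun_eq_iff indicator_def)
  then show ?thesis using locally_bv_weighted_measurable[OF assms, of 0] by simp
qed

section \<open>General monotone functions\<close>

lemma nn_integral_lebesgue_on:
  "S \<in> sets lebesgue \<Longrightarrow> (\<integral>\<^sup>+ x. g x \<partial>lebesgue_on S) = (\<integral>\<^sup>+ x. g x * indicator S x \<partial>lebesgue)"
  by (rule nn_integral_restrict_space) simp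

text \<open>For \<open>t\<close> in \<open>[a, 2a]\<close> the value \<open>|f(a)|\<close> is at most \<open>|f(t)|\<close> plus the variation of \<open>f\<close> on \<open>[a, 2a]\<close>.
  Averaging over \<open>t\<close> leaves the mean of \<open>|f|\<close> and the variation, and the \<open>GM\<close> condition bounds the
  latter. The interval reaches up to \<open>max(\<lambda>, 2) a\<close> in order to contain both \<open>[a, 2a]\<close> and
  \<open>[a/\<lambda>, \<lambda>a]\<close>.\<close>

lemma general_monotone_local_bound:
  assumes gm: "general_monotone C0 lam f" and C0: "1 < C0" and lam: "1 < lam" and a: "0 < a"
  shows "norm (f a) + variation f a (2 * a)
    \<le> ennreal (3 * C0 / a) * (\<integral>\<^sup>+ t. ennreal (norm (f t)) * indicator {a / lam..max lam 2 * a} t \<partial>lebesgue)"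
proof -
  let ?I = "\<integral>\<^sup>+ t. ennreal (norm (f t)) * indicator {a / lam..max lam 2 * a} t \<partial>lebesgue"
  let ?v = "variation f a (2 * a)"
  have bv: "locally_bv f" using gm by (simp add: general_monotone_def)
  have "?v \<le> ennreal (C0 / a) * (\<integral>\<^sup>+ t. ennreal (norm (f t)) \<partial>lebesgue_on {a / lam..lam * a})"
    using gm a by (simp add: general_monotone_def)
  also have "\<dots> \<le> ennreal (C0 / a) * ?I"
  proof -
    have "lam * a \<le> max lam 2 * a" using a by (intro mult_right_mono) auto
    then have "{a / lam..lam * a} \<subseteq> {a / lam..max lam 2 * a}" by auto
    then show ?thesis
      by (subst nn_integral_lebesgue_on) (auto intro!: mult_left_mono nn_integral_mono simp: indicator_def)
  qed
  finally have v: "?v \<le> ennreal (C0 / a) * ?I" .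
  have "ennreal (norm (f a)) * ennreal a = (\<integral>\<^sup>+ t. ennreal (norm (f a)) * indicator {a..2 * a} t \<partial>lebesgue)"
    using a by (simp add: nn_integral_cmult_indicator)
  also have "\<dots> \<le> (\<integral>\<^sup>+ t. ennreal (norm (f t)) * indicator {a..2 * a} t
      + ?v * indicator {a..2 * a} t \<partial>lebesgue)"
  proof (intro nn_integral_mono)
    fix t
    show "ennreal (norm (f a)) * indicator {a..2 * a} t
      \<le> ennreal (norm (f t)) * indicator {a..2 * a} t + ?v * indicator {a..2 * a} t"
    proof (cases "t \<in> {a..2 * a}")
      case True
      have "norm (f a) \<le> norm (f t) + norm (f t - f a)"
        using norm_triangle_ineq4[of "f t" "f t - f a"] by simp
      then have "ennreal (norm (f a)) \<le> ennreal (norm (f t)) + ennreal (norm (f t - f a))"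
        by (metis ennreal_leI ennreal_plus norm_ge_zero)
      also have "\<dots> \<le> ennreal (norm (f t)) + ?v"
        using True by (intro add_left_mono norm_diff_le_variation) auto
      finally show ?thesis using True a by simp
    qed simp
  qed
  also have "\<dots> = (\<integral>\<^sup>+ t. ennreal (norm (f t)) * indicator {a..2 * a} t \<partial>lebesgue)
      + ?v * ennreal a"
    using a by (subst nn_integral_add[OF locally_bv_norm_measurable[OF bv]])
      (auto simp: nn_integral_cmult_indicator intro!: borel_measurable_times_ennreal borel_measurable_indicator)
  also have "(\<integral>\<^sup>+ t. ennreal (norm (f t)) * indicator {a..2 * a} t \<partial>lebesgue) \<le> ?I"
  proof (intro nn_integral_mono)
    fix t
    have "{a..2 * a} \<subseteq> {a / lam..max lam 2 * a}"
      using a lam by (auto simp: divide_le_eq max_def intro: order_trans mult_right_mono[of 1, simplified])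
    then show "ennreal (norm (f t)) * indicator {a..2 * a} t
        \<le> ennreal (norm (f t)) * indicator {a / lam..max lam 2 * a} t"
      by (auto simp: indicator_def)
  qed
  finally have "ennreal (norm (f a)) * ennreal a \<le> ?I + ?v * ennreal a"
    by (simp add: add_right_mono)
  then have "ennreal (1 / a) * (ennreal (norm (f a)) * ennreal a) \<le> ennreal (1 / a) * (?I + ?v * ennreal a)"
    by (rule mult_left_mono) simp
  also have "ennreal (1 / a) * (ennreal (norm (f a)) * ennreal a) = ennreal (norm (f a))"
    using a by (simp add: ennreal_mult'[symmetric])
  also have "ennreal (1 / a) * (?I + ?v * ennreal a) = ennreal (1 / a) * ?I + ?v"
  proof -
    have "ennreal (1 / a) * (?v * ennreal a) = (ennreal (1 / a) * ennreal a) * ?v"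
      by (simp add: mult_ac)
    also have "ennreal (1 / a) * ennreal a = 1" using a by (simp add: ennreal_mult'[symmetric])
    finally show ?thesis by (simp add: distrib_left)
  qed
  finally have "ennreal (norm (f a)) + ?v \<le> ennreal (1 / a) * ?I + ?v + ?v"
    by (rule add_right_mono)
  also have "\<dots> \<le> ennreal (C0 / a) * ?I + ennreal (C0 / a) * ?I + ennreal (C0 / a) * ?I"
    using C0 a by (intro add_mono v mult_right_mono ennreal_leI) (auto simp: field_simps)
  also have "\<dots> = ennreal (3 * C0 / a) * ?I"
  proof -
    have "ennreal (3 * C0 / a) = ennreal (C0 / a) + ennreal (C0 / a) + ennreal (C0 / a)"
      using C0 a by (simp add: ennreal_plus[symmetric] del: ennreal_plus)
    then show ?thesis by (simp only: distrib_right)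
  qed
  finally show ?thesis .
qed

lemma powr_comparable:
  fixes a x L e :: real
  assumes "0 < a" "1 < L" "a / L \<le> x" "x \<le> L * a"
  shows "a powr e \<le> L powr \<bar>e\<bar> * x powr e"
proof -
  have x: "0 < x" using assms by (meson divide_pos_pos less_le_trans less_trans zero_less_one)
  have 1: "a / x \<le> L" and 2: "x / a \<le> L"
    using assms x by (simp_all add: field_simps)
  have "a powr e / x powr e \<le> L powr \<bar>e\<bar>"
  proof (cases "0 \<le> e")
    case True
    have "(a / x) powr e \<le> L powr e" using True 1 assms(1) x by (intro powr_mono2) auto
    then show ?thesis using True assms(1) x by (simp add: powr_divide)
  next
    case False
    have "(x / a) powr - e \<le> L powr - e" using False 2 assms(1) x by (intro powr_mono2) auto
    then show ?thesis using False assms(1) x by (simp add: powr_divide powr_minus field_simps)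
  qed
  then show ?thesis using x by (simp add: divide_le_eq)
qed

text \<open>A point \<open>x\<close> lies in few of the intervals attached to the dyadic blocks: if \<open>k\<^sub>0\<close> is the smallest
  admissible index, then \<open>2\<^sup>k\<^sup>-\<^sup>k\<^sup>0\<close> is at most the ratio \<open>lam * L\<close> of the endpoints of one interval.\<close>

lemma card_dyadic_multiples_le:
  fixes a x lam L :: real
  assumes a: "0 < a" "0 < lam" and m: "lam * L < 2 ^ m"
  shows "card {k. k < n \<and> a * 2 ^ k / lam \<le> x \<and> x \<le> L * (a * 2 ^ k)} \<le> m" (is "card ?K \<le> m")
proof (cases "?K = {}")
  case False
  define k0 where "k0 = Min ?K"
  have k0: "k0 \<in> ?K" unfolding k0_def using False by (intro Min_in) auto
  have "k < k0 + m" if k: "k \<in> ?K" for k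
  proof (rule ccontr)
    assume "\<not> k < k0 + m"
    then have "(2::real) ^ (k0 + m) \<le> 2 ^ k" by (intro power_increasing) auto
    then have "a * 2 ^ k0 * 2 ^ m \<le> a * 2 ^ k" using a by (simp add: power_add)
    also have "\<dots> \<le> lam * x" using k a by (simp add: field_simps)
    also have "\<dots> \<le> lam * (L * (a * 2 ^ k0))" using k0 a by simp
    also have "\<dots> = a * 2 ^ k0 * (lam * L)" by (simp add: mult_ac)
    also have "\<dots> < a * 2 ^ k0 * 2 ^ m" using a m by simp
    finally show False by simp
  qed
  moreover have "k0 \<le> k" if "k \<in> ?K" for k unfolding k0_def using that by (intro Min_le) auto
  ultimately have "?K \<subseteq> {k0..<k0 + m}" by auto
  then have "card ?K \<le> card {k0..<k0 + m}" by (intro card_mono) auto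
  then show ?thesis by simp
next
  case True
  then show ?thesis by (simp only: True card.empty le0)
qed

text \<open>Each factor of the constant has one source: \<open>40\<close> is from \<open>integral_bv_mult_bound\<close>, \<open>3 C0\<close> from
  \<open>general_monotone_local_bound\<close>, \<open>2\<^sup>b\<close> from replacing \<open>x\<^sup>b\<close> by its supremum \<open>(2a)\<^sup>b\<close>, and the last one from
  comparing \<open>a\<^sup>b\<^sup>-\<^sup>1\<close> with \<open>x\<^sup>b\<^sup>-\<^sup>1\<close>.\<close>

lemma general_monotone_block_bound:
  fixes f g G :: "real \<Rightarrow> complex"
  assumes gm: "general_monotone C0 lam f" and C0: "1 < C0" and lam: "1 < lam"
    and b: "0 \<le> b" and B: "0 \<le> B" and a: "0 < a" "a \<le> a'" "a' \<le> 2 * a"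
    and G: "\<And>x. 0 < x \<Longrightarrow> (G has_vector_derivative g x) (at x)"
    and bound: "\<And>x. a \<le> x \<Longrightarrow> norm (G x) \<le> B * x powr b"
  shows "ennreal (norm (integral {a..a'} (\<lambda>x. f x * g x)))
    \<le> ennreal (120 * B * 2 powr b * C0 * max lam 2 powr \<bar>b - 1\<bar>)
      * (\<integral>\<^sup>+ x. ennreal (x powr (b - 1) * norm (f x)) * indicator {a / lam..max lam 2 * a} x \<partial>lebesgue)"
proof -
  let ?L = "max lam 2"
  let ?M = "B * (2 * a) powr b"
  let ?I = "\<integral>\<^sup>+ x. ennreal (norm (f x)) * indicator {a / lam..?L * a} x \<partial>lebesgue"
  have fin2: "variation f a (2 * a) < \<infinity>"
    using gm a by (simp add: general_monotone_def locally_bv_def)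
  have le: "variation f a a' \<le> variation f a (2 * a)"
    using variation_add_norm_diff_le[of a a' "2 * a" f] a
    by (auto intro: order_trans[rotated] simp: add_increasing2)
  have fin: "variation f a a' < \<infinity>" using le fin2 by (rule le_less_trans)
  have "norm (integral {a..a'} (\<lambda>x. f x * g x)) \<le> 40 * ?M * (norm (f a) + enn2real (variation f a a'))"
  proof (rule integral_bv_mult_bound(2)[OF a(2) fin])
    fix x assume x: "a \<le> x" "x \<le> a'"
    show "(G has_vector_derivative g x) (at x)" using x a by (intro G) auto
    have "x powr b \<le> (2 * a) powr b" using x a b by (intro powr_mono2) auto
    then show "norm (G x) \<le> ?M" using bound[OF x(1)] B by (meson mult_left_mono order_trans)
  qed
  then have "ennreal (norm (integral {a..a'} (\<lambda>x. f x * g x)))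
      \<le> ennreal (40 * ?M) * (norm (f a) + variation f a a')"
    using fin B by (subst ennreal_enn2real[of "variation f a a'", symmetric])
      (auto simp: ennreal_plus[symmetric] ennreal_mult'[symmetric] simp del: ennreal_plus ennreal_enn2real intro!: ennreal_leI)
  also have "\<dots> \<le> ennreal (40 * ?M) * (norm (f a) + variation f a (2 * a))"
    by (intro mult_left_mono add_left_mono le) simp
  also have "\<dots> \<le> ennreal (40 * ?M) * (ennreal (3 * C0 / a) * ?I)"
    by (intro mult_left_mono general_monotone_local_bound[OF gm C0 lam a(1)]) simp
  also have "\<dots> = ennreal (120 * B * 2 powr b * C0) * (ennreal (a powr (b - 1)) * ?I)"
  proof -
    have "40 * ?M * (3 * C0 / a) = 120 * B * 2 powr b * C0 * a powr (b - 1)"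
      using a by (simp add: powr_mult powr_diff)
    then show ?thesis
      using B C0 a by (simp add: ennreal_mult'[symmetric] mult.assoc[symmetric])
  qed
  also have "ennreal (a powr (b - 1)) * ?I
      \<le> ennreal (?L powr \<bar>b - 1\<bar>)
        * (\<integral>\<^sup>+ x. ennreal (x powr (b - 1) * norm (f x)) * indicator {a / lam..?L * a} x \<partial>lebesgue)"
  proof -
    have bv: "locally_bv f" using gm by (simp add: general_monotone_def)
    have pos: "0 < x" if "a / lam \<le> x" for x
      using that a lam by (meson divide_pos_pos less_le_trans less_trans zero_less_one)
    have S: "{a / lam..?L * a} \<in> sets lebesgue" "{a / lam..?L * a} \<subseteq> {0<..}"
      using pos by auto
    have "ennreal (a powr (b - 1)) * ?I
      = (\<integral>\<^sup>+ x. ennreal (a powr (b - 1)) * (ennreal (norm (f x)) * indicator {a / lam..?L * a} x) \<partial>lebesgue)"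
      by (intro nn_integral_cmult[symmetric] locally_bv_norm_measurable[OF bv S])
    also have "\<dots> \<le> (\<integral>\<^sup>+ x. ennreal (?L powr \<bar>b - 1\<bar>)
        * (ennreal (x powr (b - 1) * norm (f x)) * indicator {a / lam..?L * a} x) \<partial>lebesgue)"
    proof (intro nn_integral_mono)
      fix x
      show "ennreal (a powr (b - 1)) * (ennreal (norm (f x)) * indicator {a / lam..?L * a} x)
        \<le> ennreal (?L powr \<bar>b - 1\<bar>) * (ennreal (x powr (b - 1) * norm (f x)) * indicator {a / lam..?L * a} x)"
      proof (cases "x \<in> {a / lam..?L * a}")
        case True
        have "a / ?L \<le> a / lam" using a lam by (intro divide_left_mono) auto
        then have "a powr (b - 1) * norm (f x) \<le> ?L powr \<bar>b - 1\<bar> * x powr (b - 1) * norm (f x)"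
          using True a by (intro mult_right_mono powr_comparable) auto
        then have "ennreal (a powr (b - 1) * norm (f x)) \<le> ennreal (?L powr \<bar>b - 1\<bar> * (x powr (b - 1) * norm (f x)))"
          by (simp add: ennreal_leI mult.assoc)
        then show ?thesis using True by (simp add: ennreal_mult'[symmetric])
      qed simp
    qed
    also have "\<dots> = ennreal (?L powr \<bar>b - 1\<bar>)
        * (\<integral>\<^sup>+ x. ennreal (x powr (b - 1) * norm (f x)) * indicator {a / lam..?L * a} x \<partial>lebesgue)"
      by (intro nn_integral_cmult locally_bv_weighted_measurable[OF bv S])
    finally show ?thesis .
  qed
  finally show ?thesis
    using B C0 by (simp add: ennreal_mult'' mult.assoc mult_left_mono)
qed

text \<open>The interval is cut at the points \<open>2\<^sup>k a\<close>. The intervals on the right-hand sides of the block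
  bounds cover no point more than \<open>m\<close> times, and they all lie to the right of \<open>a/\<lambda>\<close>. The bound does
  not depend on \<open>N\<close>, which is what makes it a tail estimate.\<close>

lemma general_monotone_tail_bound:
  fixes f g G :: "real \<Rightarrow> complex"
  assumes gm: "general_monotone C0 lam f" and C0: "1 < C0" and lam: "1 < lam"
    and b: "0 \<le> b" and B: "0 \<le> B" and a: "0 < a" "a \<le> N"
    and G: "\<And>x. 0 < x \<Longrightarrow> (G has_vector_derivative g x) (at x)"
    and bound: "\<And>x. a \<le> x \<Longrightarrow> norm (G x) \<le> B * x powr b"
    and m: "lam * max lam 2 < 2 ^ m"
  shows "ennreal (norm (integral {a..N} (\<lambda>x. f x * g x)))
    \<le> ennreal (real m * (120 * B * 2 powr b * C0 * max lam 2 powr \<bar>b - 1\<bar>))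
      * (\<integral>\<^sup>+ x. ennreal (x powr (b - 1) * norm (f x)) * indicator {a / lam..} x \<partial>lebesgue)"
proof -
  let ?D = "120 * B * 2 powr b * C0 * max lam 2 powr \<bar>b - 1\<bar>"
  let ?w = "\<lambda>x. ennreal (x powr (b - 1) * norm (f x))"
  let ?J = "\<lambda>k. {a * 2 ^ k / lam..max lam 2 * (a * 2 ^ k)}"
  have bv: "locally_bv f" using gm by (simp add: general_monotone_def)
  have int: "(\<lambda>x. f x * g x) integrable_on {s..t}" if "0 < s" "s \<le> t" for s t
  proof (cases "s < t")
    case True
    have cont: "continuous_on {s..t} G"
      using that by (intro continuous_at_imp_continuous_on ballI has_vector_derivative_continuous[OF G]) auto
    then obtain M where M: "\<forall>x\<in>{s..t}. norm (G x) \<le> M"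
      using compact_imp_bounded[OF compact_continuous_image[OF cont]] by (auto simp: bounded_iff)
    show ?thesis
      using bv that True M
      by (intro integral_bv_mult_bound(1)[of s t f G g M] G) (auto simp: locally_bv_def)
  qed (use that integrable_on_refl[of _ t] in simp)
  \<comment> \<open>The endpoint \<open>N\<close> is arbitrary, so the last block may be incomplete.\<close>
  have dyadic: "ennreal (norm (integral {a..N} (\<lambda>x. f x * g x)))
      \<le> (\<Sum>k<n. ennreal ?D * (\<integral>\<^sup>+ x. ?w x * indicator (?J k) x \<partial>lebesgue))"
    if "a \<le> N" "N \<le> a * 2 ^ n" for n N
    using that
  proof (induction n arbitrary: N)
    case 0
    then show ?case by simp
  next
    case (Suc n)
    let ?S = "\<Sum>k<n. ennreal ?D * (\<integral>\<^sup>+ x. ?w x * indicator (?J k) x \<partial>lebesgue)"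
    show ?case
    proof (cases "N \<le> a * 2 ^ n")
      case True
      then have "ennreal (norm (integral {a..N} (\<lambda>x. f x * g x))) \<le> ?S"
        using Suc by blast
      then show ?thesis by (simp add: add_increasing2)
    next
      case False
      define a' where "a' = a * 2 ^ n"
      have a': "0 < a'" "a \<le> a'" "a' \<le> N" "N \<le> 2 * a'"
        using False Suc.prems a by (simp_all add: a'_def)
      have "integral {a..N} (\<lambda>x. f x * g x)
          = integral {a..a'} (\<lambda>x. f x * g x) + integral {a'..N} (\<lambda>x. f x * g x)"
        using a a' Suc.prems by (intro Henstock_Kurzweil_Integration.integral_combine[symmetric] int) auto
      then have "norm (integral {a..N} (\<lambda>x. f x * g x))
          \<le> norm (integral {a..a'} (\<lambda>x. f x * g x)) + norm (integral {a'..N} (\<lambda>x. f x * g x))"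
        by (simp only: norm_triangle_ineq)
      from ennreal_leI[OF this] have "ennreal (norm (integral {a..N} (\<lambda>x. f x * g x)))
          \<le> ennreal (norm (integral {a..a'} (\<lambda>x. f x * g x))) + ennreal (norm (integral {a'..N} (\<lambda>x. f x * g x)))"
        by (simp only: ennreal_plus norm_ge_zero)
      also have "\<dots> \<le> ?S + ennreal ?D * (\<integral>\<^sup>+ x. ?w x * indicator (?J n) x \<partial>lebesgue)"
        using general_monotone_block_bound[OF gm C0 lam b B a'(1,3,4) G bound] a'(2) Suc.IH[of a']
        by (intro add_mono) (auto simp: a'_def)
      finally show ?thesis by simp
    qed
  qed
  obtain n where n: "N / a < 2 ^ n" using real_arch_pow[of 2 "N / a"] by auto
  have [measurable]: "(\<lambda>x::real. x powr (b - 1)) \<in> borel_measurable lebesgue"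
    by (intro measurable_completion) measurable
  have pos: "0 < x" if "a * 2 ^ k / lam \<le> x" for x k
  proof -
    have "0 < a * 2 ^ k / lam" using a lam by simp
    then show ?thesis using that by (rule less_le_trans)
  qed
  have S: "?J k \<in> sets lebesgue" "?J k \<subseteq> {0<..}" "{a / lam..} \<in> sets lebesgue" "{a / lam..} \<subseteq> {0<..}" for k
    using pos[of k] pos[of 0] by auto
  have "ennreal (norm (integral {a..N} (\<lambda>x. f x * g x)))
      \<le> (\<Sum>k<n. ennreal ?D * (\<integral>\<^sup>+ x. ?w x * indicator (?J k) x \<partial>lebesgue))"
    using n a by (intro dyadic) (auto simp: field_simps)
  also have "\<dots> = ennreal ?D * (\<integral>\<^sup>+ x. (\<Sum>k<n. ?w x * indicator (?J k) x) \<partial>lebesgue)"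
    by (subst nn_integral_sum) (auto simp: sum_distrib_left intro!: locally_bv_weighted_measurable[OF bv] S(2))
  also have "\<dots> \<le> ennreal ?D * (\<integral>\<^sup>+ x. ennreal (real m) * (?w x * indicator {a / lam..} x) \<partial>lebesgue)"
  proof (intro mult_left_mono nn_integral_mono)
    fix x
    let ?K = "{k. k < n \<and> a * 2 ^ k / lam \<le> x \<and> x \<le> max lam 2 * (a * 2 ^ k)}"
    have K: "card ?K \<le> m"
      using lam by (intro card_dyadic_multiples_le[OF a(1) _ m]) simp
    have "(\<Sum>k<n. indicator (?J k) x :: ennreal) = of_nat (card ?K)"
    proof -
      have "(\<Sum>k<n. indicator (?J k) x :: ennreal) = (\<Sum>k<n. of_bool (k \<in> ?K))"
        by (intro sum.cong) (auto simp: indicator_def)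
      also have "\<dots> = of_nat (card ?K)"
        by (subst sum_of_bool_eq) (auto intro!: arg_cong[where f=card])
      finally show ?thesis .
    qed
    also have "\<dots> \<le> of_nat m * indicator {a / lam..} x"
    proof (cases "a / lam \<le> x")
      case True
      then show ?thesis using K by simp
    next
      case False
      have "a / lam \<le> a * 2 ^ k / lam" for k
        using a lam by (intro divide_right_mono) auto
      then have "?K = {}" using False by (auto dest: order_trans)
      then show ?thesis by (simp only: card.empty) simp
    qed
    finally have "?w x * (\<Sum>k<n. indicator (?J k) x) \<le> ?w x * (of_nat m * indicator {a / lam..} x)"
      by (rule mult_left_mono) simp
    then show "(\<Sum>k<n. ?w x * indicator (?J k) x) \<le> ennreal (real m) * (?w x * indicator {a / lam..} x)"
      by (simp add: sum_distrib_left mult_ac ennreal_of_nat_eq_real_of_nat)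
  qed simp
  also have "\<dots> = ennreal (real m * ?D) * (\<integral>\<^sup>+ x. ?w x * indicator {a / lam..} x \<partial>lebesgue)"
    using B C0 by (subst nn_integral_cmult[OF locally_bv_weighted_measurable[OF bv S(3,4)]])
      (simp add: ennreal_mult mult_ac)
  finally show ?thesis .
qed

section \<open>The integral transform of an admissible function\<close>

lemma AE_lebesgue_neq: "AE x in lebesgue. x \<noteq> (c::real)"
  by (intro AE_completion AE_lborel_singleton)

text \<open>The Cauchy criterion for \<open>R \<rightarrow> \<infinity>\<close>, with the bound on the limit that the tail estimate at \<open>R0\<close> provides.\<close>

lemma tendsto_at_top_of_tail_bound:
  fixes \<Phi> :: "real \<Rightarrow> 'a::banach"
  assumes tail: "\<And>R R'. R0 \<le> R \<Longrightarrow> R \<le> R' \<Longrightarrow> norm (\<Phi> R' - \<Phi> R) \<le> \<delta> R"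
    and \<delta>: "(\<delta> \<longlongrightarrow> 0) at_top"
  obtains I where "(\<Phi> \<longlongrightarrow> I) at_top" and "norm I \<le> norm (\<Phi> R0) + \<delta> R0"
proof -
  have "Cauchy (\<lambda>n::nat. \<Phi> (real n))"
  proof (rule CauchyI')
    fix e :: real assume "0 < e"
    then have "\<forall>\<^sub>F R in at_top. \<delta> R < e" using \<delta> by (auto dest: order_tendstoD)
    then obtain R1 where R1: "\<And>R. R1 \<le> R \<Longrightarrow> \<delta> R < e" by (auto simp: eventually_at_top_linorder)
    obtain N :: nat where N: "max R0 R1 \<le> real N" using real_arch_simple by blast
    show "\<exists>M. \<forall>m\<ge>M. \<forall>n>m. dist (\<Phi> (real m)) (\<Phi> (real n)) < e"
    proof (intro exI allI impI)
      fix m n :: nat assume "N \<le> m" "m < n"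
      then have "max R0 R1 \<le> real m" using N by simp
      then show "dist (\<Phi> (real m)) (\<Phi> (real n)) < e"
        using tail[of "real m" "real n"] R1[of "real m"] \<open>m < n\<close> by (simp add: dist_norm norm_minus_commute)
    qed
  qed
  then obtain I where I: "(\<lambda>n::nat. \<Phi> (real n)) \<longlonglongrightarrow> I" using Cauchy_convergent convergent_def by blast
  have bound: "norm (I - \<Phi> R) \<le> \<delta> R" if "R0 \<le> R" for R
  proof (rule tendsto_upperbound)
    show "(\<lambda>n::nat. norm (\<Phi> (real n) - \<Phi> R)) \<longlonglongrightarrow> norm (I - \<Phi> R)"
      by (intro tendsto_intros I)
    obtain N :: nat where "R \<le> real N" using real_arch_simple by blast
    then show "\<forall>\<^sub>F n in sequentially. norm (\<Phi> (real n) - \<Phi> R) \<le> \<delta> R"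
      by (intro eventually_sequentiallyI[of N] tail that) auto
  qed simp
  have "((\<lambda>R. I - \<Phi> R) \<longlongrightarrow> 0) at_top"
    using bound by (intro Lim_null_comparison[OF _ \<delta>]) (auto simp: eventually_at_top_linorder)
  from tendsto_diff[OF tendsto_const[of I] this] have "(\<Phi> \<longlongrightarrow> I) at_top" by simp
  moreover have "norm I \<le> norm (\<Phi> R0) + \<delta> R0"
    using bound[of R0] norm_triangle_ineq[of "I - \<Phi> R0" "\<Phi> R0"] by simp
  ultimately show thesis by (rule that)
qed

lemma nn_integral_tail_tendsto_0:
  fixes w :: "real \<Rightarrow> ennreal"
  assumes [measurable]: "w \<in> borel_measurable lebesgue"
    and fin: "\<And>s. 0 < s \<Longrightarrow> (\<integral>\<^sup>+ x. w x * indicator {s..} x \<partial>lebesgue) < top"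
  shows "((\<lambda>R. enn2real (\<integral>\<^sup>+ x. w x * indicator {R..} x \<partial>lebesgue)) \<longlongrightarrow> 0) at_top"
proof -
  define T where "T R = (\<integral>\<^sup>+ x. w x * indicator {R..} x \<partial>lebesgue)" for R
  have T: "T R = emeasure (density lebesgue w) {R..}" for R
    unfolding T_def by (rule emeasure_density[symmetric]) auto
  have mono: "T R' \<le> T R" if "R \<le> R'" for R R'
    unfolding T using that by (intro emeasure_mono) auto
  have "(INF n::nat. T (real (Suc n))) = emeasure (density lebesgue w) (\<Inter>n::nat. {real (Suc n)..})"
    unfolding T using fin by (intro INF_emeasure_decseq) (auto simp: decseq_def T[symmetric] T_def less_top[symmetric] simp del: of_nat_Suc)
  also have "(\<Inter>n::nat. {real (Suc n)..}) = {}"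
  proof -
    have "\<exists>n::nat. \<not> real (Suc n) \<le> x" for x
      using reals_Archimedean2[of x] by (metis not_le less_trans of_nat_less_iff lessI)
    then show ?thesis by (auto simp del: of_nat_Suc)
  qed
  finally have inf: "(INF n::nat. T (real (Suc n))) = 0" by simp
  have "((\<lambda>R. enn2real (T R)) \<longlongrightarrow> 0) at_top"
  proof (rule tendstoI)
    fix e :: real assume e: "0 < e"
    then have "\<exists>n. T (real (Suc n)) < ennreal e"
      using inf INF_less_iff[of "\<lambda>n::nat. T (real (Suc n))" UNIV "ennreal e"] by auto
    then obtain n where n: "T (real (Suc n)) < ennreal e" by blast
    show "\<forall>\<^sub>F R in at_top. dist (enn2real (T R)) 0 < e"
    proof (rule eventually_at_top_linorderI)
      fix R assume "real (Suc n) \<le> R"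
      then have "T R < ennreal e" using mono n by (meson le_less_trans)
      then show "dist (enn2real (T R)) 0 < e"
        using e by (cases "T R") (auto simp: ennreal_less_iff)
    qed
  qed
  then show ?thesis by (simp add: T_def)
qed

text \<open>Admissibility splits the half-line at \<open>1\<close>, whereas the integrals below are split elsewhere. The
  difference is an integral over a compact interval, whose finiteness comes from this lemma.\<close>

lemma locally_bv_weighted_bounded:
  fixes g :: "real \<Rightarrow> complex"
  assumes bv: "locally_bv f" and s: "0 < s" and g: "continuous_on {0<..} g"
  obtains M where "0 \<le> M" "\<And>x. s \<le> x \<Longrightarrow> x \<le> t \<Longrightarrow> norm (g x) * norm (f x) \<le> M"
proof -
  let ?t = "max t (s + 1)"
  have v: "variation f s ?t < \<infinity>" using bv s by (simp add: locally_bv_def)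
  have "continuous_on {s..?t} g" using g by (rule continuous_on_subset) (use s in auto)
  then have "bounded (g ` {s..?t})" by (intro compact_imp_bounded compact_continuous_image) auto
  then obtain Mg where Mg: "\<forall>x\<in>{s..?t}. norm (g x) \<le> Mg" by (auto simp: bounded_iff)
  have f: "norm (f x) \<le> norm (f s) + enn2real (variation f s ?t)" if "s \<le> x" "x \<le> ?t" for x
  proof -
    have "ennreal (norm (f x - f s)) \<le> variation f s ?t" using that by (intro norm_diff_le_variation) auto
    then have "norm (f x - f s) \<le> enn2real (variation f s ?t)" using v
      by (metis enn2real_ennreal enn2real_mono infinity_ennreal_def norm_ge_zero)
    then show ?thesis using norm_triangle_ineq2[of "f x" "f s"] by simp
  qed
  show thesis
  proof
    show "norm (g x) * norm (f x) \<le> \<bar>Mg\<bar> * (norm (f s) + enn2real (variation f s ?t))"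
      if "s \<le> x" "x \<le> t" for x
      using Mg f[of x] that by (intro mult_mono) (auto intro: order_trans[OF _ abs_ge_self])
  qed simp
qed

lemma admissible_tail_finite:
  assumes bv: "locally_bv f" and adm: "admissible b0 b1 b f" and s: "0 < s"
  shows "(\<integral>\<^sup>+ x. ennreal (x powr (b - 1) * norm (f x)) * indicator {s..} x \<partial>lebesgue) < top"
proof -
  have "continuous_on {0<..} (\<lambda>x. complex_of_real (x powr (b - 1)))"
    by (intro continuous_intros) auto
  from locally_bv_weighted_bounded[OF bv s this, of 1] obtain M where
    M: "0 \<le> M" "\<And>x. s \<le> x \<Longrightarrow> x \<le> 1 \<Longrightarrow> x powr (b - 1) * norm (f x) \<le> M"
    by (auto simp: norm_of_real)
  have "(\<integral>\<^sup>+ x. ennreal (x powr (b - 1) * norm (f x)) * indicator {s..} x \<partial>lebesgue)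
     \<le> (\<integral>\<^sup>+ x. ennreal M * indicator {s..1} x + ennreal (x powr (b - 1) * norm (f x)) * indicator {1<..} x \<partial>lebesgue)"
    using M by (intro nn_integral_mono) (auto simp: indicator_def intro!: ennreal_leI)
  also have "\<dots> = (\<integral>\<^sup>+ x. ennreal M * indicator {s..1} x \<partial>lebesgue)
      + (\<integral>\<^sup>+ x. ennreal (x powr (b - 1) * norm (f x)) * indicator {1<..} x \<partial>lebesgue)"
    by (intro nn_integral_add locally_bv_weighted_measurable[OF bv] borel_measurable_times_ennreal borel_measurable_indicator) auto
  also have "\<dots> < top"
    using adm by (auto simp: admissible_def nn_integral_lebesgue_on nn_integral_cmult_indicator emeasure_lborel_Icc_eq ennreal_mult_less_top)
  finally show ?thesis .
qed

lemma admissible_head_finite: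
  assumes bv: "locally_bv f" and adm: "admissible b0 b1 b f"
  shows "(\<integral>\<^sup>+ x. ennreal (x powr (b0 + b1) * norm (f x)) * indicator {0<..<r} x \<partial>lebesgue) < top"
proof -
  have "continuous_on {0<..} (\<lambda>x. complex_of_real (x powr (b0 + b1)))"
    by (intro continuous_intros) auto
  from locally_bv_weighted_bounded[OF bv _ this, of 1 r] obtain M where
    M: "0 \<le> M" "\<And>x. 1 \<le> x \<Longrightarrow> x \<le> r \<Longrightarrow> x powr (b0 + b1) * norm (f x) \<le> M"
    by (auto simp: norm_of_real)
  have "(\<integral>\<^sup>+ x. ennreal (x powr (b0 + b1) * norm (f x)) * indicator {0<..<r} x \<partial>lebesgue)
     \<le> (\<integral>\<^sup>+ x. ennreal M * indicator {1..r} x + ennreal (x powr (b0 + b1) * norm (f x)) * indicator {0<..<1} x \<partial>lebesgue)"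
    using M by (intro nn_integral_mono) (auto simp: indicator_def intro!: ennreal_leI)
  also have "\<dots> = (\<integral>\<^sup>+ x. ennreal M * indicator {1..r} x \<partial>lebesgue)
      + (\<integral>\<^sup>+ x. ennreal (x powr (b0 + b1) * norm (f x)) * indicator {0<..<1} x \<partial>lebesgue)"
    by (intro nn_integral_add locally_bv_weighted_measurable[OF bv] borel_measurable_times_ennreal borel_measurable_indicator) auto
  also have "\<dots> < top"
    using adm by (auto simp: admissible_def nn_integral_lebesgue_on nn_integral_cmult_indicator emeasure_lborel_Icc_eq ennreal_mult_less_top)
  finally show ?thesis .
qed

text \<open>The variable \<open>y\<close> of the transform is fixed here: the application has \<open>R = 1/y\<close>, and the powers of
  \<open>y\<close> are part of \<open>A\<close> and \<open>B\<close>. The first term bounds the integral over \<open>(0, R)\<close>, the second the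
  limit of the integrals over \<open>(R, r)\<close>.\<close>

lemma transform_bound:
  fixes K G :: "real \<Rightarrow> complex"
  assumes gm: "general_monotone C0 lam f" and adm: "admissible b0 b1 b f"
    and C0: "1 < C0" and lam: "1 < lam" and b: "0 \<le> b" and R: "0 < R"
    and A: "0 \<le> A" and B: "0 \<le> B"
    and K_cont: "continuous_on {0<..} K"
    and K_bound: "\<And>x. 0 < x \<Longrightarrow> x < R \<Longrightarrow> norm (K x) \<le> A * x powr b1"
    and G: "\<And>x. 0 < x \<Longrightarrow> (G has_vector_derivative (of_real (x powr b0) * K x)) (at x)"
    and G_bound: "\<And>x. R \<le> x \<Longrightarrow> norm (G x) \<le> B * x powr b"
    and m: "lam * max lam 2 < 2 ^ m"
  obtains I where "has_improper_integral (\<lambda>x. of_real (x powr b0) * f x * K x) I"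
    and "ennreal (norm I)
      \<le> ennreal A * (\<integral>\<^sup>+ x. ennreal (x powr (b0 + b1) * norm (f x)) * indicator {0<..<R} x \<partial>lebesgue)
      + ennreal (real m * (120 * B * 2 powr b * C0 * max lam 2 powr \<bar>b - 1\<bar>))
        * (\<integral>\<^sup>+ x. ennreal (x powr (b - 1) * norm (f x)) * indicator {R / lam<..} x \<partial>lebesgue)"
proof -
  define h where "h x = of_real (x powr b0) * f x * K x" for x
  define E where "E = real m * (120 * B * 2 powr b * C0 * max lam 2 powr \<bar>b - 1\<bar>)"
  have E: "0 \<le> E" using B C0 by (simp add: E_def)
  define T where "T s = (\<integral>\<^sup>+ x. ennreal (x powr (b - 1) * norm (f x)) * indicator {s..} x \<partial>lebesgue)" for s
  have bv: "locally_bv f" using gm by (simp add: general_monotone_def)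
  have T_fin: "T s < top" if "0 < s" for s
    unfolding T_def by (rule admissible_tail_finite[OF bv adm that])
  have g_cont: "continuous_on {0<..} (\<lambda>x. of_real (x powr b0) * K x)"
    by (intro continuous_intros K_cont) auto
  have h_meas: "h \<in> borel_measurable (lebesgue_on {0<..})"
  proof -
    have "(\<lambda>x. complex_of_real (x powr b0) * K x) \<in> borel_measurable (lebesgue_on {0<..})"
      using g_cont by (intro continuous_imp_measurable_on_sets_lebesgue) auto
    then have "(\<lambda>x. f x * (complex_of_real (x powr b0) * K x)) \<in> borel_measurable (lebesgue_on {0<..})"
      by (rule borel_measurable_times[OF locally_bv_borel_measurable[OF bv]])
    also have "(\<lambda>x. f x * (complex_of_real (x powr b0) * K x)) = h"
      by (simp add: h_def fun_eq_iff)
    finally show ?thesis .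
  qed
  have head: "(\<integral>\<^sup>+ x. ennreal (norm (h x)) * indicator {0<..<R} x \<partial>lebesgue)
      \<le> ennreal A * (\<integral>\<^sup>+ x. ennreal (x powr (b0 + b1) * norm (f x)) * indicator {0<..<R} x \<partial>lebesgue)"
  proof -
    have "(\<integral>\<^sup>+ x. ennreal (norm (h x)) * indicator {0<..<R} x \<partial>lebesgue)
        \<le> (\<integral>\<^sup>+ x. ennreal A * (ennreal (x powr (b0 + b1) * norm (f x)) * indicator {0<..<R} x) \<partial>lebesgue)"
    proof (intro nn_integral_mono)
      fix x
      show "ennreal (norm (h x)) * indicator {0<..<R} x
          \<le> ennreal A * (ennreal (x powr (b0 + b1) * norm (f x)) * indicator {0<..<R} x)"
      proof (cases "x \<in> {0<..<R}")
        case True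
        have "norm (h x) = x powr b0 * norm (f x) * norm (K x)" by (simp add: h_def norm_mult)
        also have "\<dots> \<le> x powr b0 * norm (f x) * (A * x powr b1)"
          using True by (intro mult_left_mono K_bound) auto
        also have "\<dots> = A * (x powr (b0 + b1) * norm (f x))" by (simp add: powr_add)
        finally show ?thesis using True A by (simp add: ennreal_mult'[symmetric] ennreal_leI)
      qed simp
    qed
    also have "\<dots> = ennreal A * (\<integral>\<^sup>+ x. ennreal (x powr (b0 + b1) * norm (f x)) * indicator {0<..<R} x \<partial>lebesgue)"
      by (intro nn_integral_cmult locally_bv_weighted_measurable[OF bv]) auto
    finally show ?thesis .
  qed
  have h_int: "integrable (lebesgue_on {0<..<r}) h" for r
  proof (rule integrableI_bounded)
    show "h \<in> borel_measurable (lebesgue_on {0<..<r})"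
      using h_meas by (rule measurable_restrict_mono) auto
    from locally_bv_weighted_bounded[OF bv R g_cont, of r] obtain M where
      M: "0 \<le> M" "\<And>x. R \<le> x \<Longrightarrow> x \<le> r \<Longrightarrow> norm (h x) \<le> M"
      by (auto simp: h_def norm_mult mult_ac)
    have "(\<integral>\<^sup>+ x. ennreal (norm (h x)) \<partial>lebesgue_on {0<..<r})
        \<le> (\<integral>\<^sup>+ x. ennreal M * indicator {R..r} x + ennreal (norm (h x)) * indicator {0<..<R} x \<partial>lebesgue)"
      using M by (subst nn_integral_lebesgue_on)
        (auto intro!: nn_integral_mono ennreal_leI simp: indicator_def)
    also have "\<dots> = (\<integral>\<^sup>+ x. ennreal M * indicator {R..r} x \<partial>lebesgue)
        + (\<integral>\<^sup>+ x. ennreal (norm (h x)) * indicator {0<..<R} x \<partial>lebesgue)"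
    proof (intro nn_integral_add)
      have "h \<in> borel_measurable (lebesgue_on {0<..<R})"
        using h_meas by (rule measurable_restrict_mono) auto
      then have "(\<lambda>x. ennreal (norm (h x))) \<in> borel_measurable (lebesgue_on {0<..<R})" by measurable
      then show "(\<lambda>x. ennreal (norm (h x)) * indicator {0<..<R} x) \<in> borel_measurable lebesgue"
        by (subst (asm) borel_measurable_restrict_space_iff_ennreal) auto
    qed (auto intro!: borel_measurable_times_ennreal borel_measurable_indicator)
    also have "\<dots> < top"
      using le_less_trans[OF head] admissible_head_finite[OF bv adm, of R]
      by (auto simp: nn_integral_cmult_indicator emeasure_lborel_Icc_eq ennreal_mult_less_top)
    finally show "(\<integral>\<^sup>+ x. ennreal (norm (h x)) \<partial>lebesgue_on {0<..<r}) < \<infinity>" by simp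
  qed
  define \<Phi> where "\<Phi> r = integral\<^sup>L (lebesgue_on {0<..<r}) h" for r
  define \<delta> where "\<delta> r = E * enn2real (T (r / lam))" for r
  have \<Phi>: "\<Phi> r = integral {0..r} h" "h integrable_on {0..r}" for r
  proof -
    have "(h has_integral \<Phi> r) {0..r}"
      using has_integral_integral_lebesgue_on[OF h_int[of r]] has_integral_open_interval[of h "\<Phi> r" 0 r]
      by (simp add: \<Phi>_def)
    then show "\<Phi> r = integral {0..r} h" "h integrable_on {0..r}"
      by (auto simp: integral_unique has_integral_integrable)
  qed
  have tail: "norm (\<Phi> r' - \<Phi> r) \<le> \<delta> r" if "R \<le> r" "r \<le> r'" for r r'
  proof -
    have r: "0 < r" using that R by simp
    have "\<Phi> r' = \<Phi> r + integral {r..r'} h"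
      unfolding \<Phi> using r that \<Phi>(2) by (intro Henstock_Kurzweil_Integration.integral_combine[symmetric]) auto
    then have "ennreal (norm (\<Phi> r' - \<Phi> r))
        = ennreal (norm (integral {r..r'} (\<lambda>x. f x * (of_real (x powr b0) * K x))))"
      by (simp add: h_def[abs_def] mult_ac)
    also have "\<dots> \<le> ennreal E * T (r / lam)"
      unfolding E_def T_def using that
      by (intro general_monotone_tail_bound[OF gm C0 lam b B r that(2) G _ m]) (auto intro: G_bound)
    also have "\<dots> = ennreal (\<delta> r)"
      using T_fin[of "r / lam"] r lam E by (simp add: \<delta>_def ennreal_mult)
    finally show ?thesis
      using E by (subst (asm) ennreal_le_iff) (auto simp: \<delta>_def)
  qed
  have "((\<lambda>r. enn2real (T r)) \<longlongrightarrow> 0) at_top"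
  proof -
    define w where "w x = ennreal (x powr (b - 1) * norm (f x)) * indicator {0<..} x" for x
    have w: "(\<integral>\<^sup>+ x. w x * indicator {s..} x \<partial>lebesgue) = T s" if "0 < s" for s
      unfolding w_def T_def using that by (intro nn_integral_cong) (auto simp: indicator_def)
    have "((\<lambda>r. enn2real (\<integral>\<^sup>+ x. w x * indicator {r..} x \<partial>lebesgue)) \<longlongrightarrow> 0) at_top"
    proof (rule nn_integral_tail_tendsto_0)
      show "w \<in> borel_measurable lebesgue"
        unfolding w_def by (intro locally_bv_weighted_measurable[OF bv]) auto
    qed (simp add: w T_fin)
    then show ?thesis
      by (rule Lim_transform_eventually) (auto intro!: eventually_at_top_linorderI[of 1] simp: w)
  qed
  moreover have "filterlim (\<lambda>r. r / lam) at_top at_top"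
    unfolding filterlim_at_top
  proof
    fix Z
    show "\<forall>\<^sub>F r in at_top. Z \<le> r / lam"
      using lam by (intro eventually_at_top_linorderI[of "Z * lam"]) (simp add: field_simps)
  qed
  ultimately have "((\<lambda>r. enn2real (T (r / lam))) \<longlongrightarrow> 0) at_top"
    by (rule filterlim_compose)
  then have \<delta>: "(\<delta> \<longlongrightarrow> 0) at_top"
    unfolding \<delta>_def by (rule tendsto_mult_right_zero)
  obtain I where I: "(\<Phi> \<longlongrightarrow> I) at_top" "norm I \<le> norm (\<Phi> R) + \<delta> R"
    using tendsto_at_top_of_tail_bound[of R \<Phi> \<delta>] tail \<delta> by blast
  show thesis
  proof
    show "has_improper_integral (\<lambda>x. of_real (x powr b0) * f x * K x) I"
      using I(1) h_int unfolding has_improper_integral_def \<Phi>_def h_def by simp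
    have "ennreal (norm I) \<le> ennreal (norm (\<Phi> R) + \<delta> R)"
      using I(2) by (rule ennreal_leI)
    also have "\<dots> = ennreal (norm (\<Phi> R)) + ennreal (\<delta> R)"
      using E by (intro ennreal_plus) (auto simp: \<delta>_def)
    also have "ennreal (norm (\<Phi> R)) \<le> (\<integral>\<^sup>+ x. ennreal (norm (h x)) * indicator {0<..<R} x \<partial>lebesgue)"
      using integral_norm_bound_ennreal[OF h_int[of R]] by (simp add: \<Phi>_def nn_integral_lebesgue_on)
    also note head
    also have "ennreal (\<delta> R) = ennreal E * T (R / lam)"
      using T_fin[of "R / lam"] R lam E by (simp add: \<delta>_def ennreal_mult)
    also have "T (R / lam) = (\<integral>\<^sup>+ x. ennreal (x powr (b - 1) * norm (f x)) * indicator {R / lam<..} x \<partial>lebesgue)"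
      unfolding T_def using AE_lebesgue_neq[of "R / lam"]
      by (intro nn_integral_cong_AE) (auto simp: indicator_def elim!: eventually_mono)
    finally show "ennreal (norm I)
      \<le> ennreal A * (\<integral>\<^sup>+ x. ennreal (x powr (b0 + b1) * norm (f x)) * indicator {0<..<R} x \<partial>lebesgue)
      + ennreal (real m * (120 * B * 2 powr b * C0 * max lam 2 powr \<bar>b - 1\<bar>))
        * (\<integral>\<^sup>+ x. ennreal (x powr (b - 1) * norm (f x)) * indicator {R / lam<..} x \<partial>lebesgue)"
      by (simp add: E_def add_right_mono)
  qed
qed

section \<open>Hardy's inequality on the half-line and the weighted norm inequality\<close>

text \<open>The case of Lebesgue measure with power weights, in which the measure \<open>N\<close> of \<open>hardy_inequality\<close>
  has the density \<open>u(y) y\<^sup>\<beta>\<^sup>q\<close>; the power \<open>y\<^sup>\<beta>\<close> is the factor in front of the integral.\<close>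

lemma hardy_inequality_halfline:
  fixes u v \<tau> \<sigma> :: "real \<Rightarrow> real" and f :: "real \<Rightarrow> complex" and \<alpha> \<beta> :: real
  defines "M \<equiv> lebesgue_on {0<..}"
  assumes p: "1 < p" "p \<le> q" and C: "0 < C"
  defines "p' \<equiv> conj_exponent p"
  assumes u: "u \<in> borel_measurable M" "\<And>x. 0 < x \<Longrightarrow> 0 \<le> u x"
    and v: "v \<in> borel_measurable M" "\<And>x. 0 < x \<Longrightarrow> 0 \<le> v x"
    and f: "f \<in> borel_measurable M"
    and \<tau>: "continuous_on {0<..} \<tau>" "\<And>r. AE x in M. \<tau> x \<noteq> r" and \<sigma>: "continuous_on {0<..} \<sigma>"
    and fin: "\<And>r. (\<integral>\<^sup>+ x. ennreal (x powr \<alpha> * norm (f x)) * indicator {x. \<tau> x < r} x \<partial>M) < top"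
    and test: "\<And>r. ennpowr (\<integral>\<^sup>+ y. ennreal (u y * y powr (\<beta> * q)) * indicator {y. r < \<sigma> y} y \<partial>M) (1 / q)
        * ennpowr (\<integral>\<^sup>+ x. ennpowr (ennreal (v x)) (1 - p') * ennreal (x powr (\<alpha> * p'))
                    * indicator {x. \<tau> x < r} x \<partial>M) (1 / p') \<le> ennreal C"
  defines "H \<equiv> \<lambda>y. \<integral>\<^sup>+ x. ennreal (x powr \<alpha> * norm (f x)) * indicator {x. \<tau> x < \<sigma> y} x \<partial>M"
  shows "H \<in> borel_measurable M"
    and "(\<integral>\<^sup>+ y. ennreal (u y * y powr (\<beta> * q)) * ennpowr (H y) q \<partial>M)
      \<le> ennreal ((8 * C) powr q) * ennpowr (\<integral>\<^sup>+ x. ennreal (v x * norm (f x) powr p) \<partial>M) (q / p)"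
proof -
  have cont_meas: "g \<in> borel_measurable M" if "continuous_on {0<..} g" for g :: "real \<Rightarrow> real"
    unfolding M_def using that by (rule continuous_imp_measurable_on_sets_lebesgue) simp
  note [measurable] = u(1) v(1) f
  have [measurable]: "\<tau> \<in> borel_measurable M" "\<sigma> \<in> borel_measurable M"
    "(\<lambda>x. x powr e) \<in> borel_measurable M" for e
    by (intro cont_meas \<tau> \<sigma> continuous_intros; simp)+
  have sp: "space M = {0<..}" by (simp add: M_def)
  show H[measurable]: "H \<in> borel_measurable M"
    unfolding H_def
    using measurable_compose[OF _ sublevel_integral_measurable[OF fin], of \<sigma> M] by simp
  define N where "N = density M (\<lambda>y. ennreal (u y * y powr (\<beta> * q)))"
  have N: "emeasure N {y \<in> space N. r < \<sigma> y}
      = (\<integral>\<^sup>+ y. ennreal (u y * y powr (\<beta> * q)) * indicator {y. r < \<sigma> y} y \<partial>M)" for r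
    unfolding N_def by (subst emeasure_density) (auto intro!: nn_integral_cong simp: indicator_def)
  have "(\<integral>\<^sup>+ y. ennpowr (H y) q \<partial>N)
      \<le> ennreal ((8 * C) powr q) * ennpowr (\<integral>\<^sup>+ x. ennreal (v x * norm (f x) powr p) \<partial>M) (q / p)"
    unfolding H_def
  proof (rule hardy_inequality[OF p C])
    fix r
    show "ennpowr (emeasure N {y \<in> space N. r < \<sigma> y}) (1 / q)
        * ennpowr (\<integral>\<^sup>+ x. ennpowr (ennreal (v x)) (1 - conj_exponent p) * ennreal ((x powr \<alpha>) powr conj_exponent p)
                    * indicator {x. \<tau> x < r} x \<partial>M) (1 / conj_exponent p) \<le> ennreal C"
      using test[of r] by (simp add: N powr_powr p'_def)
  qed (use \<tau>(2) fin v(2) in \<open>auto simp: N_def sp\<close>)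
  also have "(\<integral>\<^sup>+ y. ennpowr (H y) q \<partial>N) = (\<integral>\<^sup>+ y. ennreal (u y * y powr (\<beta> * q)) * ennpowr (H y) q \<partial>M)"
  proof -
    have [measurable]: "(\<lambda>y. ennpowr (H y) q) \<in> borel_measurable M"
      unfolding ennpowr_def by measurable
    show ?thesis unfolding N_def by (subst nn_integral_density) auto
  qed
  finally show "(\<integral>\<^sup>+ y. ennreal (u y * y powr (\<beta> * q)) * ennpowr (H y) q \<partial>M)
      \<le> ennreal ((8 * C) powr q) * ennpowr (\<integral>\<^sup>+ x. ennreal (v x * norm (f x) powr p) \<partial>M) (q / p)" .
qed

lemma nn_integral_lebesgue_on_restrict:
  fixes S :: "real set"
  assumes "S \<in> sets lebesgue" "\<And>x. x \<in> S \<longleftrightarrow> 0 < x \<and> P x"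
  shows "(\<integral>\<^sup>+ x. g x * indicator {x. P x} x \<partial>lebesgue_on {0<..}) = (\<integral>\<^sup>+ x. g x \<partial>lebesgue_on S)"
proof -
  have "g x * indicator {x. P x} x * indicator {0<..} x = g x * indicator S x" for x
    using assms(2)[of x] by (auto simp: indicator_def)
  moreover have "{0<..} \<in> sets (lebesgue :: real measure)" by simp
  ultimately show ?thesis by (simp only: nn_integral_lebesgue_on assms(1))
qed

lemma has_improper_integral_unique:
  "has_improper_integral g I \<Longrightarrow> has_improper_integral g J \<Longrightarrow> I = J"
  unfolding has_improper_integral_def using tendsto_unique trivial_limit_at_top_linorder by blast

theorem theorem6p6:
  fixes p q b0 b1 c0 c1 b c lam C0 :: real
    and K G :: "real \<Rightarrow> real \<Rightarrow> complex"
    and u v :: "real \<Rightarrow> real"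
  assumes "1 < p" and "p \<le> q" and "0 \<le> b"
    and "\<And>y. y > 0 \<Longrightarrow> continuous_on {0<..} (\<lambda>x. K x y)"
    and "\<exists>A>0. \<forall>x>0. \<forall>y>0. x * y < 1 \<longrightarrow> norm (K x y) \<le> A * x powr b1 * y powr c1"
    and "\<And>x y. x > 0 \<Longrightarrow> y > 0 \<Longrightarrow>
           ((\<lambda>x. G x y) has_vector_derivative (of_real (x powr b0) * K x y)) (at x)"
    and "\<exists>A>0. \<forall>x>0. \<forall>y>0. x * y \<ge> 1 \<longrightarrow> norm (G x y) \<le> A * x powr b * y powr c"
    and "u \<in> borel_measurable (lebesgue_on {0<..})" and "\<And>x. x > 0 \<Longrightarrow> 0 \<le> u x"
    and "v \<in> borel_measurable (lebesgue_on {0<..})" and "\<And>x. x > 0 \<Longrightarrow> 0 \<le> v x"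
    and "lam > 1" and "C0 > 1"
    and "\<exists>C>0. \<forall>r>0.
      ennpowr (\<integral>\<^sup>+ y. ennreal (u y * y powr ((c0 + c1) * q)) \<partial>lebesgue_on {0<..<1 / r}) (1 / q)
      * ennpowr (\<integral>\<^sup>+ x. ennpowr (ennreal (v x)) (1 - conj_exponent p)
                        * ennreal (x powr ((b0 + b1) * conj_exponent p))
                 \<partial>lebesgue_on {0<..<r}) (1 / conj_exponent p)
        \<le> ennreal C
      \<and>
      ennpowr (\<integral>\<^sup>+ y. ennreal (u y * y powr ((c + c0) * q)) \<partial>lebesgue_on {1 / (lam * r)<..}) (1 / q)
      * ennpowr (\<integral>\<^sup>+ x. ennpowr (ennreal (v x)) (1 - conj_exponent p)
                        * ennreal (x powr ((b - 1) * conj_exponent p))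
                 \<partial>lebesgue_on {r<..}) (1 / conj_exponent p)
        \<le> ennreal C"
  shows "\<exists>D>0. \<forall>f. general_monotone C0 lam f \<and> admissible b0 b1 b f \<longrightarrow>
      (\<forall>y>0. \<exists>I. has_improper_integral (transform_integrand b0 K f y) I) \<and>
      weighted_norm q u (transform b0 c0 K f) \<le> ennreal D * weighted_norm p v f"
proof -
  note p = assms(1,2) and b = assms(3) and u = assms(8,9) and v = assms(10,11)
    and lam = assms(12) and C0 = assms(13)
  have q: "0 < q" using p by simp
  let ?M = "lebesgue_on {0::real<..}"
  obtain A where A: "0 < A"
    "\<And>x y. 0 < x \<Longrightarrow> 0 < y \<Longrightarrow> x * y < 1 \<Longrightarrow> norm (K x y) \<le> A * x powr b1 * y powr c1"
    using assms(5) by blast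
  obtain B where B: "0 < B"
    "\<And>x y. 0 < x \<Longrightarrow> 0 < y \<Longrightarrow> 1 \<le> x * y \<Longrightarrow> norm (G x y) \<le> B * x powr b * y powr c"
    using assms(7) by blast
  obtain C where C: "0 < C"
    "\<And>r. 0 < r \<Longrightarrow> ennpowr (\<integral>\<^sup>+ y. ennreal (u y * y powr ((c0 + c1) * q)) \<partial>lebesgue_on {0<..<1 / r}) (1 / q)
      * ennpowr (\<integral>\<^sup>+ x. ennpowr (ennreal (v x)) (1 - conj_exponent p)
                        * ennreal (x powr ((b0 + b1) * conj_exponent p))
                 \<partial>lebesgue_on {0<..<r}) (1 / conj_exponent p) \<le> ennreal C"
    "\<And>r. 0 < r \<Longrightarrow> ennpowr (\<integral>\<^sup>+ y. ennreal (u y * y powr ((c + c0) * q)) \<partial>lebesgue_on {1 / (lam * r)<..}) (1 / q)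
      * ennpowr (\<integral>\<^sup>+ x. ennpowr (ennreal (v x)) (1 - conj_exponent p)
                        * ennreal (x powr ((b - 1) * conj_exponent p))
                 \<partial>lebesgue_on {r<..}) (1 / conj_exponent p) \<le> ennreal C"
    using assms(14) by blast
  obtain m where m: "lam * max lam 2 < 2 ^ m" using real_arch_pow[of 2] by auto
  define E where "E = real m * (120 * B * 2 powr b * C0 * max lam 2 powr \<bar>b - 1\<bar>)"
  have E: "0 \<le> E" using B C0 by (simp add: E_def)
  \<comment> \<open>The factor \<open>2\<^sup>q\<close> is from splitting the \<open>q\<close>-th power of a sum, \<open>(8 C)\<^sup>q\<close> from Hardy's inequality.\<close>
  define Q where "Q = 2 powr q * (A powr q + E powr q) * (8 * C) powr q"
  have Q: "0 < Q" using A C by (simp add: Q_def add_pos_nonneg)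
  have main: "(\<forall>y>0. \<exists>I. has_improper_integral (transform_integrand b0 K f y) I) \<and>
      weighted_norm q u (transform b0 c0 K f) \<le> ennreal (Q powr (1 / q)) * weighted_norm p v f"
    if gm: "general_monotone C0 lam f" and adm: "admissible b0 b1 b f" for f
  proof -
    have bv: "locally_bv f" using gm by (simp add: general_monotone_def)
    note f = locally_bv_borel_measurable[OF bv]
    define X where "X = (\<integral>\<^sup>+ x. ennreal (v x * norm (f x) powr p) \<partial>?M)"
    define H1 where "H1 y = (\<integral>\<^sup>+ x. ennreal (x powr (b0 + b1) * norm (f x)) * indicator {x. ln x < - ln y} x \<partial>?M)" for y
    define H2 where "H2 y = (\<integral>\<^sup>+ x. ennreal (x powr (b - 1) * norm (f x)) * indicator {x. - ln x < ln (lam * y)} x \<partial>?M)" for y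
    have ln_less: "ln x < r \<longleftrightarrow> x < exp r" "r < ln x \<longleftrightarrow> exp r < x" if "0 < x" for x r :: real
      using that by (metis exp_less_cancel_iff exp_ln)+
    have AE_ln: "AE x in ?M. ln x \<noteq> r" for r
    proof -
      have "AE x in lebesgue. x \<in> {0<..} \<longrightarrow> ln x \<noteq> r"
        using AE_lebesgue_neq[of "exp r"] by (rule eventually_mono) auto
      then show ?thesis by (subst AE_restrict_space_iff) auto
    qed
    \<comment> \<open>The sublevel sets of \<open>ln x\<close> and \<open>- ln x\<close>, and the superlevel sets of \<open>- ln y\<close> and
      \<open>ln (lam * y)\<close>, are the intervals in the two conditions on \<open>u\<close> and \<open>v\<close>, taken at \<open>exp r\<close> and at
      \<open>exp (- r)\<close>.\<close>
    have sub1: "x \<in> {0<..<exp r} \<longleftrightarrow> 0 < x \<and> ln x < r" for x r :: real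
      using ln_less(1)[of x r] by auto
    have sub2: "x \<in> {exp (- r)<..} \<longleftrightarrow> 0 < x \<and> - ln x < r" for x r :: real
      using ln_less(2)[of x "- r"] exp_gt_zero[of "- r"] by (auto simp: minus_less_iff simp del: exp_gt_zero)
    have sub3: "y \<in> {0<..<1 / exp r} \<longleftrightarrow> 0 < y \<and> r < - ln y" for y r :: real
      using ln_less(1)[of y "- r"] by (auto simp: exp_minus inverse_eq_divide less_minus_iff)
    have sub4: "y \<in> {1 / (lam * exp (- r))<..} \<longleftrightarrow> 0 < y \<and> r < ln (lam * y)" for y r :: real
    proof -
      have "1 / (lam * exp (- r)) = exp r / lam" by (simp add: exp_minus field_simps)
      moreover have "0 < exp r / lam" using lam by simp
      moreover have "exp r / lam < y \<longleftrightarrow> exp r < lam * y" using lam by (simp add: field_simps)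
      moreover have "0 < y" if "exp r < lam * y"
        using less_trans[OF exp_gt_zero that] lam by (simp add: zero_less_mult_iff)
      moreover have "exp r < lam * y \<longleftrightarrow> r < ln (lam * y)" if "0 < y"
        using ln_less(2)[of "lam * y" r] lam that by simp
      ultimately show ?thesis by auto
    qed
    have fin1: "(\<integral>\<^sup>+ x. ennreal (x powr (b0 + b1) * norm (f x)) * indicator {x. ln x < r} x \<partial>?M) < top" for r
        using admissible_head_finite[OF bv adm, of "exp r"]
        by (subst nn_integral_lebesgue_on_restrict[OF _ sub1]) (auto simp: nn_integral_lebesgue_on)
    have test1: "ennpowr (\<integral>\<^sup>+ y. ennreal (u y * y powr ((c0 + c1) * q)) * indicator {y. r < - ln y} y \<partial>?M) (1 / q)
        * ennpowr (\<integral>\<^sup>+ x. ennpowr (ennreal (v x)) (1 - conj_exponent p)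
            * ennreal (x powr ((b0 + b1) * conj_exponent p)) * indicator {x. ln x < r} x \<partial>?M) (1 / conj_exponent p)
        \<le> ennreal C" for r
        using C(2)[of "exp r"]
        by (simp add: nn_integral_lebesgue_on_restrict[OF _ sub1] nn_integral_lebesgue_on_restrict[OF _ sub3])
    have cont1: "continuous_on {0<..} (ln :: real \<Rightarrow> real)" "continuous_on {0<..} ((\<lambda>y. - ln y) :: real \<Rightarrow> real)"
      using lam by (auto intro!: continuous_intros)
    have H1: "H1 \<in> borel_measurable ?M"
        "(\<integral>\<^sup>+ y. ennreal (u y * y powr ((c0 + c1) * q)) * ennpowr (H1 y) q \<partial>?M)
          \<le> ennreal ((8 * C) powr q) * ennpowr X (q / p)"
      using hardy_inequality_halfline[OF p C(1) u v f cont1(1) AE_ln cont1(2) fin1 test1]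
      by (simp_all only: H1_def[abs_def] X_def)
    have fin2: "(\<integral>\<^sup>+ x. ennreal (x powr (b - 1) * norm (f x)) * indicator {x. - ln x < r} x \<partial>?M) < top" for r
      proof (subst nn_integral_lebesgue_on_restrict[OF _ sub2])
        have "(\<integral>\<^sup>+ x. ennreal (x powr (b - 1) * norm (f x)) * indicator {exp (- r)<..} x \<partial>lebesgue)
          \<le> (\<integral>\<^sup>+ x. ennreal (x powr (b - 1) * norm (f x)) * indicator {exp (- r)..} x \<partial>lebesgue)"
          by (intro nn_integral_mono) (auto simp: indicator_def)
        also have "\<dots> < top" by (rule admissible_tail_finite[OF bv adm]) simp
        finally show "(\<integral>\<^sup>+ x. ennreal (x powr (b - 1) * norm (f x)) \<partial>lebesgue_on {exp (- r)<..}) < top"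
          by (subst nn_integral_lebesgue_on) auto
      qed simp
    have test2: "ennpowr (\<integral>\<^sup>+ y. ennreal (u y * y powr ((c + c0) * q)) * indicator {y. r < ln (lam * y)} y \<partial>?M) (1 / q)
        * ennpowr (\<integral>\<^sup>+ x. ennpowr (ennreal (v x)) (1 - conj_exponent p)
            * ennreal (x powr ((b - 1) * conj_exponent p)) * indicator {x. - ln x < r} x \<partial>?M) (1 / conj_exponent p)
        \<le> ennreal C" for r
        using C(3)[of "exp (- r)"]
        by (simp add: nn_integral_lebesgue_on_restrict[OF _ sub2] nn_integral_lebesgue_on_restrict[OF _ sub4])
    have AE_ln': "AE x in ?M. - ln x \<noteq> r" for r
      using AE_ln[of "- r"] by (rule eventually_mono) auto
    have cont2: "continuous_on {0<..} ((\<lambda>x. - ln x) :: real \<Rightarrow> real)" "continuous_on {0<..} ((\<lambda>y. ln (lam * y)) :: real \<Rightarrow> real)"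
      using lam by (auto intro!: continuous_intros)
    have H2: "H2 \<in> borel_measurable ?M"
        "(\<integral>\<^sup>+ y. ennreal (u y * y powr ((c + c0) * q)) * ennpowr (H2 y) q \<partial>?M)
          \<le> ennreal ((8 * C) powr q) * ennpowr X (q / p)"
      using hardy_inequality_halfline[OF p C(1) u v f cont2(1) AE_ln' cont2(2) fin2 test2]
      by (simp_all only: H2_def[abs_def] X_def)
    have exists: "\<exists>I. has_improper_integral (transform_integrand b0 K f y) I"
      and pointwise: "ennreal (norm (transform b0 c0 K f y))
        \<le> ennreal (A * y powr (c0 + c1)) * H1 y + ennreal (E * y powr (c + c0)) * H2 y" if y: "0 < y" for y
    proof -
      obtain I where I: "has_improper_integral (\<lambda>x. of_real (x powr b0) * f x * K x y) I"
        "ennreal (norm I)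
          \<le> ennreal (A * y powr c1) * (\<integral>\<^sup>+ x. ennreal (x powr (b0 + b1) * norm (f x)) * indicator {0<..<1 / y} x \<partial>lebesgue)
          + ennreal (real m * (120 * (B * y powr c) * 2 powr b * C0 * max lam 2 powr \<bar>b - 1\<bar>))
            * (\<integral>\<^sup>+ x. ennreal (x powr (b - 1) * norm (f x)) * indicator {1 / y / lam<..} x \<partial>lebesgue)"
      proof (rule transform_bound[OF gm adm C0 lam b, where R = "1 / y" and A = "A * y powr c1"
            and B = "B * y powr c" and K = "\<lambda>x. K x y" and G = "\<lambda>x. G x y" and m = m])
        show "norm (K x y) \<le> A * y powr c1 * x powr b1" if "0 < x" "x < 1 / y" for x
          using A(2)[of x y] that y by (simp add: field_simps)
        show "norm (G x y) \<le> B * y powr c * x powr b" if "1 / y \<le> x" for x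
          using B(2)[of x y] that y less_le_trans[of 0 "1 / y" x] by (simp add: field_simps)
      qed (use y A B m assms(4,6) in auto)
      show "\<exists>I. has_improper_integral (transform_integrand b0 K f y) I"
        using I(1) by (auto simp: transform_integrand_def)
      have "transform b0 c0 K f y = of_real (y powr c0) * I"
        unfolding transform_def transform_integrand_def
        using I(1) has_improper_integral_unique by (metis (mono_tags, lifting) the_equality)
      then have "ennreal (norm (transform b0 c0 K f y)) = ennreal (y powr c0) * ennreal (norm I)"
        by (simp add: norm_mult ennreal_mult)
      also have "\<dots> \<le> ennreal (y powr c0) * (ennreal (A * y powr c1) * H1 y + ennreal (E * y powr c) * H2 y)"
      proof (intro mult_left_mono)
        have "exp (- ln y) = 1 / y" "exp (- ln (lam * y)) = 1 / y / lam"
          using y lam by (simp_all add: exp_minus field_simps)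
        moreover have "H1 y = (\<integral>\<^sup>+ x. ennreal (x powr (b0 + b1) * norm (f x)) \<partial>lebesgue_on {0<..<exp (- ln y)})"
          unfolding H1_def by (rule nn_integral_lebesgue_on_restrict[OF _ sub1]) simp
        moreover have "H2 y = (\<integral>\<^sup>+ x. ennreal (x powr (b - 1) * norm (f x)) \<partial>lebesgue_on {exp (- ln (lam * y))<..})"
          unfolding H2_def by (rule nn_integral_lebesgue_on_restrict[OF _ sub2]) simp
        ultimately have "H1 y = (\<integral>\<^sup>+ x. ennreal (x powr (b0 + b1) * norm (f x)) * indicator {0<..<1 / y} x \<partial>lebesgue)"
          "H2 y = (\<integral>\<^sup>+ x. ennreal (x powr (b - 1) * norm (f x)) * indicator {1 / y / lam<..} x \<partial>lebesgue)"
          by (simp_all add: nn_integral_lebesgue_on)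
        moreover have "real m * (120 * (B * y powr c) * 2 powr b * C0 * max lam 2 powr \<bar>b - 1\<bar>) = E * y powr c"
          by (simp add: E_def)
        ultimately show "ennreal (norm I) \<le> ennreal (A * y powr c1) * H1 y + ennreal (E * y powr c) * H2 y"
          using I(2) by (simp only:)
      qed simp
      also have "\<dots> = ennreal (A * y powr (c0 + c1)) * H1 y + ennreal (E * y powr (c + c0)) * H2 y"
        using A(1) E by (simp add: distrib_left powr_add ennreal_mult mult_ac)
      finally show "ennreal (norm (transform b0 c0 K f y))
        \<le> ennreal (A * y powr (c0 + c1)) * H1 y + ennreal (E * y powr (c + c0)) * H2 y" .
    qed
    have pow: "ennpowr (ennreal (D * y powr e) * h) q = ennreal (D powr q) * (ennreal (y powr (e * q)) * ennpowr h q)"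
      if "0 \<le> D" for D y e h
      using that q by (simp add: ennpowr_mult ennpowr_ennreal powr_mult powr_powr ennreal_mult mult.assoc)
    have "(\<integral>\<^sup>+ y. ennreal (u y * norm (transform b0 c0 K f y) powr q) \<partial>?M)
      \<le> (\<integral>\<^sup>+ y. ennreal (2 powr q * A powr q) * (ennreal (u y * y powr ((c0 + c1) * q)) * ennpowr (H1 y) q)
          + ennreal (2 powr q * E powr q) * (ennreal (u y * y powr ((c + c0) * q)) * ennpowr (H2 y) q) \<partial>?M)"
    proof (intro nn_integral_mono)
      fix y assume "y \<in> space ?M"
      then have y: "0 < y" by simp
      have "ennreal (norm (transform b0 c0 K f y) powr q) = ennpowr (ennreal (norm (transform b0 c0 K f y))) q"
        using q by (simp add: ennpowr_ennreal)
      also have "\<dots> \<le> ennpowr (ennreal (A * y powr (c0 + c1)) * H1 y + ennreal (E * y powr (c + c0)) * H2 y) q"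
        by (intro ennpowr_mono q pointwise y)
      also have "\<dots> \<le> ennreal (2 powr q) * (ennreal (A powr q) * (ennreal (y powr ((c0 + c1) * q)) * ennpowr (H1 y) q)
          + ennreal (E powr q) * (ennreal (y powr ((c + c0) * q)) * ennpowr (H2 y) q))"
        unfolding pow[OF less_imp_le[OF A(1)], symmetric] pow[OF E, symmetric] by (rule ennpowr_sum_le[OF q])
      finally have "ennreal (u y) * ennreal (norm (transform b0 c0 K f y) powr q) \<le> ennreal (u y) * \<dots>"
        by (rule mult_left_mono) simp
      then show "ennreal (u y * norm (transform b0 c0 K f y) powr q)
        \<le> ennreal (2 powr q * A powr q) * (ennreal (u y * y powr ((c0 + c1) * q)) * ennpowr (H1 y) q)
          + ennreal (2 powr q * E powr q) * (ennreal (u y * y powr ((c + c0) * q)) * ennpowr (H2 y) q)"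
        using u(2)[OF y] by (simp add: ennreal_mult distrib_left mult_ac)
    qed
    also have "\<dots> = ennreal (2 powr q * A powr q) * (\<integral>\<^sup>+ y. ennreal (u y * y powr ((c0 + c1) * q)) * ennpowr (H1 y) q \<partial>?M)
        + ennreal (2 powr q * E powr q) * (\<integral>\<^sup>+ y. ennreal (u y * y powr ((c + c0) * q)) * ennpowr (H2 y) q \<partial>?M)"
    proof -
      note [measurable] = H1(1) H2(1) u(1)
      have [measurable]: "(\<lambda>y. ennpowr (H1 y) q) \<in> borel_measurable ?M" "(\<lambda>y. ennpowr (H2 y) q) \<in> borel_measurable ?M"
        unfolding ennpowr_def by measurable
      have [measurable]: "(\<lambda>y. y powr e) \<in> borel_measurable ?M" for e :: real
        by (intro continuous_imp_measurable_on_sets_lebesgue continuous_intros) auto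
      show ?thesis by (subst nn_integral_add) (auto simp: nn_integral_cmult)
    qed
    also have "\<dots> \<le> ennreal (2 powr q * A powr q) * (ennreal ((8 * C) powr q) * ennpowr X (q / p))
        + ennreal (2 powr q * E powr q) * (ennreal ((8 * C) powr q) * ennpowr X (q / p))"
      by (intro add_mono mult_left_mono H1 H2) auto
    also have "\<dots> = ennreal Q * ennpowr X (q / p)"
      by (simp add: Q_def ennreal_mult distrib_right distrib_left mult_ac)
    finally have "weighted_norm q u (transform b0 c0 K f) \<le> ennpowr (ennreal Q * ennpowr X (q / p)) (1 / q)"
      unfolding weighted_norm_def using q by (intro ennpowr_mono) auto
    also have "\<dots> = ennreal (Q powr (1 / q)) * weighted_norm p v f"
      using p q Q by (simp add: ennpowr_mult ennpowr_ennpowr ennpowr_ennreal weighted_norm_def X_def)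
    finally show ?thesis using exists by blast
  qed
  show ?thesis
    using main Q by (intro exI[of _ "Q powr (1 / q)"]) auto
qed

end
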